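(* Let $(K(x)|K,v)$ be a valued rational function field in one variable (i.e., $x$ is transcendental over $K$ and $v$ is a valuation on $K(x)$). Then one and only one of the following three cases holds: 1) $vK(x)\simeq\Gamma_0\oplus\mathbb{Z}$ (isomorphism over $vK$), where $\Gamma_0|vK$ is a finite extension of ordered abelian groups, and $K(x)v|Kv$ is finite; 2) $vK(x)/vK$ is finite, and $K(x)v$ is a rational function field in one variable over a finite extension of $Kv$; 3) $vK(x)/vK$ is a torsion group and $K(x)v|Kv$ is algebraic. In all cases, $vK(x)/vK$ is countable and $K(x)v|Kv$ is countably generated.
   Context: For a valued field $(L,v)$, $vL$ denotes the value group and $Lv$ the residue field; $(L|K,v)$ denotes a field extension $L|K$ with a valuation $v$ on $L$ and its restriction to $K$. A finite extension $\Gamma_0|vK$ of ordered abelian groups is an extension of finite index. *)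

theory Defs
  imports "HOL-Algebra.Algebra" "HOL-Library.Countable_Set"
begin

subsection \<open>Valued fields\<close>

text \<open>
  Valuations are written additively, with values in an arbitrary ordered abelian group.
  The conventional value \<open>\<infinity>\<close> at zero is not represented: \<open>v \<zero>\<close> is arbitrary and never used.
  The map need not be onto the type \<open>'g\<close>; the value group is its range on nonzero elements.
\<close>

locale valued_field = field L for L (structure) +
  fixes v :: "'a \<Rightarrow> 'g::linordered_ab_group_add"
  assumes val_mult: "\<lbrakk>a \<in> carrier L - {\<zero>}; b \<in> carrier L - {\<zero>}\<rbrakk> \<Longrightarrow> v (a \<otimes> b) = v a + v b"
    and val_add: "\<lbrakk>a \<in> carrier L - {\<zero>}; b \<in> carrier L - {\<zero>}; a \<oplus> b \<noteq> \<zero>\<rbrakk>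
                    \<Longrightarrow> min (v a) (v b) \<le> v (a \<oplus> b)"

definition value_set :: "('a, 'b) ring_scheme \<Rightarrow> ('a \<Rightarrow> 'g) \<Rightarrow> 'a set \<Rightarrow> 'g set"
  where "value_set L v K = v ` (K - {\<zero>\<^bsub>L\<^esub>})"

definition val_ring :: "('a, 'b) ring_scheme \<Rightarrow> ('a \<Rightarrow> 'g::linordered_ab_group_add) \<Rightarrow> ('a, 'b) ring_scheme"
  where "val_ring L v = L\<lparr>carrier := {a \<in> carrier L. a = \<zero>\<^bsub>L\<^esub> \<or> 0 \<le> v a}\<rparr>"

definition val_ideal :: "('a, 'b) ring_scheme \<Rightarrow> ('a \<Rightarrow> 'g::linordered_ab_group_add) \<Rightarrow> 'a set"
  where "val_ideal L v = {a \<in> carrier L. a = \<zero>\<^bsub>L\<^esub> \<or> 0 < v a}"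

definition residue_field :: "('a, 'b) ring_scheme \<Rightarrow> ('a \<Rightarrow> 'g::linordered_ab_group_add) \<Rightarrow> 'a set ring"
  where "residue_field L v = val_ring L v Quot val_ideal L v"

text \<open>
  For a subfield \<open>K\<close> of \<open>L\<close>, the residue field of \<open>K\<close> under the restriction of \<open>v\<close>, in its
  canonical embedding into the residue field of \<open>L\<close>.
\<close>

definition residue_subfield ::
    "('a, 'b) ring_scheme \<Rightarrow> ('a \<Rightarrow> 'g::linordered_ab_group_add) \<Rightarrow> 'a set \<Rightarrow> 'a set set"
  where "residue_subfield L v K =
    (\<lambda>a. val_ideal L v +>\<^bsub>val_ring L v\<^esub> a) ` (K \<inter> carrier (val_ring L v))"

subsection \<open>Extensions of ordered abelian groups\<close>

definition add_grp :: "'g::ab_group_add set \<Rightarrow> 'g monoid"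
  where "add_grp A = \<lparr>carrier = A, monoid.mult = (+), one = 0\<rparr>"

definition torsion_group :: "('a, 'b) monoid_scheme \<Rightarrow> bool"
  where "torsion_group G \<longleftrightarrow> (\<forall>a \<in> carrier G. \<exists>n::nat. n > 0 \<and> a [^]\<^bsub>G\<^esub> n = \<one>\<^bsub>G\<^esub>)"

text \<open>Ordered groups are subgroups of one ordered abelian group \<open>'g\<close>, with the induced order.\<close>

definition finite_group_extension :: "'g::linordered_ab_group_add set \<Rightarrow> 'g set \<Rightarrow> bool"
  where "finite_group_extension A B \<longleftrightarrow>
    subgroup A (add_grp UNIV) \<and> subgroup B (add_grp UNIV) \<and> A \<subseteq> B \<and>
    finite (carrier (add_grp B Mod A))"

definition iso_sum_integers_over ::
    "'g::linordered_ab_group_add set \<Rightarrow> 'g set \<Rightarrow> 'g set \<Rightarrow> bool"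
  where "iso_sum_integers_over A B C \<longleftrightarrow>
    (\<exists>h \<in> iso (add_grp C) (add_grp B \<times>\<times> integer_group). \<forall>a \<in> A. h a = (a, 0))"

subsection \<open>Field extensions\<close>

definition rational_function_field :: "('a, 'b) ring_scheme \<Rightarrow> 'a set \<Rightarrow> 'a \<Rightarrow> bool"
  where "rational_function_field L K x \<longleftrightarrow>
    field L \<and> subfield K L \<and> x \<in> carrier L \<and> (ring.transcendental L over K) x \<and>
    generate_field L (insert x K) = carrier L"

definition algebraic_field_extension :: "('a, 'b) ring_scheme \<Rightarrow> 'a set \<Rightarrow> bool"
  where "algebraic_field_extension L K \<longleftrightarrow> (\<forall>y \<in> carrier L. (ring.algebraic L over K) y)"

definition rational_over_finite_extension :: "('a, 'b) ring_scheme \<Rightarrow> 'a set \<Rightarrow> bool"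
  where "rational_over_finite_extension L K \<longleftrightarrow>
    (\<exists>E t. subfield E L \<and> K \<subseteq> E \<and> ring.finite_dimension L K E \<and> rational_function_field L E t)"

definition countably_generated_field_extension :: "('a, 'b) ring_scheme \<Rightarrow> 'a set \<Rightarrow> bool"
  where "countably_generated_field_extension L K \<longleftrightarrow>
    (\<exists>C \<subseteq> carrier L. countable C \<and> generate_field L (K \<union> C) = carrier L)"

end

theory Submission
  imports Defs
begin

text \<open>
  Call \<open>r \<noteq> 0\<close> of algebraic type if \<open>c r\<^sup>n\<close> is, for some \<open>n > 0\<close> and \<open>c\<close> in \<open>K\<close>, a unit whose residue
  is algebraic over \<open>Kv\<close>. If all polynomials in \<open>x\<close> are of algebraic type, case 3 holds. Otherwise let
  \<open>Q\<close> be a polynomial of least degree \<open>d\<close> that is not. Up to 1-units, the nonzero polynomials of degree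
  less than \<open>d\<close> form a group \<open>G\<close>, since a multiple of \<open>Q\<close> cannot cancel against elements of algebraic
  type. As these polynomials span a space of dimension \<open>d\<close>, \<open>v G\<close> has finite index over \<open>vK\<close>, and the
  residues of units in \<open>G\<close> form a finite extension \<open>E\<close> of \<open>Kv\<close>. Leading terms of \<open>Q\<close>-adic expansions
  then give case 1 with \<open>\<Gamma>\<^sub>0 = v G\<close>, if no positive multiple of \<open>v Q\<close> lies in \<open>v G\<close>; and otherwise case
  2, where \<open>K(x)v = E(t)\<close> for the residue \<open>t\<close> of \<open>h Q\<^sup>e\<close>, with \<open>e > 0\<close> least such that \<open>e v Q\<close> lies in
  \<open>v G\<close>, and \<open>h\<close> in \<open>G\<close> of value \<open>- e v Q\<close>.
\<close>

subsection \<open>Valuation rings and residue fields\<close>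

text \<open>An element fails to be of algebraic type for one of two reasons: its value is not
  torsion modulo \<open>vK\<close>, or it is, and the unit obtained by scaling a power has
  transcendental residue. The notion covers both, so one polynomial \<open>Q\<close> serves cases 1
  and 2, and which of them occurs is decided only when \<open>v Q\<close> is compared with the
  values of \<open>G\<close>. The obstacle is that polynomials of degree below \<open>d\<close> are
  closed neither under products nor under inverses. Reduction modulo \<open>Q\<close> repairs this
  only if the discarded multiple of \<open>Q\<close> has larger value than the remainder, and
  algebraic type forces exactly that: let \<open>r\<close> and \<open>r + z\<close> be of algebraic
  type and \<open>z\<close> not. If \<open>v z < v r\<close>, then \<open>z\<close> would agree with
  \<open>r + z\<close> up to a 1-unit; if \<open>v z = v r\<close>, then \<open>z / r\<close> would
  have an algebraic residue. Hence \<open>v z > v r\<close>. Finiteness rests on a count in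
  finite-dimensional \<open>K\<close>-spaces: such a space has finitely many values modulo
  \<open>vK\<close> and a residue space of finite dimension. Applied to all degree bounds, the same
  count gives the two countability claims in every case.\<close>

lemma (in field) nz_mult: "\<lbrakk>a \<in> carrier R - {\<zero>}; b \<in> carrier R - {\<zero>}\<rbrakk> \<Longrightarrow> a \<otimes> b \<in> carrier R - {\<zero>}"
  by (auto simp: integral_iff)

lemma (in field) nz_inv: "a \<in> carrier R - {\<zero>} \<Longrightarrow> inv a \<in> carrier R - {\<zero>}"
  using group.inv_closed[OF field_mult_group, of a] m_inv_mult_of[of a] by simp

lemma (in field) nz_pow: "a \<in> carrier R - {\<zero>} \<Longrightarrow> a [^] (n::nat) \<in> carrier R - {\<zero>}"
  by (induct n) (auto simp: integral_iff)

lemma (in field) nz_minus: "a \<in> carrier R - {\<zero>} \<Longrightarrow> \<ominus> a \<in> carrier R - {\<zero>}"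
  by auto

lemma (in field) nz_r_inv [simp]: "a \<in> carrier R - {\<zero>} \<Longrightarrow> a \<otimes> inv a = \<one>"
  and nz_l_inv [simp]: "a \<in> carrier R - {\<zero>} \<Longrightarrow> inv a \<otimes> a = \<one>"
  using field_Units by auto

lemma (in field) mult_inv_cancel:
  assumes "a \<in> carrier R" "b \<in> carrier R - {\<zero>}"
  shows "(a \<otimes> inv b) \<otimes> b = a" and "(a \<otimes> b) \<otimes> inv b = a"
  using assms nz_inv[of b] by (auto simp: m_assoc)

lemma (in field) inv_mult_nz:
  assumes "a \<in> carrier R - {\<zero>}" "b \<in> carrier R - {\<zero>}"
  shows "inv (a \<otimes> b) = inv a \<otimes> inv b"
proof -
  have "(a \<otimes> b) \<otimes> (inv a \<otimes> inv b) = (a \<otimes> inv a) \<otimes> (b \<otimes> inv b)"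
    using assms nz_inv by (simp add: m_ac)
  then show ?thesis using assms nz_inv comm_inv_char[of "a \<otimes> b" "inv a \<otimes> inv b"]
    by auto
qed

lemma (in field) inv_inv_nz: "a \<in> carrier R - {\<zero>} \<Longrightarrow> inv (inv a) = a"
  using field_Units Units_inv_inv by blast

lemma (in field) inv_pow_nz:
  assumes "a \<in> carrier R - {\<zero>}" shows "inv a [^] (n::nat) = inv (a [^] n)"
proof (induct n)
  case (Suc n)
  have "inv (a [^] n \<otimes> a) = inv (a [^] n) \<otimes> inv a" by (rule inv_mult_nz[OF nz_pow[OF assms] assms])
  with Suc show ?case by simp
qed simp

context valued_field
begin

abbreviation "nz \<equiv> carrier L - {\<zero>}"

lemma val_one [simp]: "v \<one> = 0"
  using val_mult[of \<one> \<one>] by simp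

lemma val_inv: assumes "a \<in> nz" shows "v (inv a) = - v a"
proof -
  have "v a + v (inv a) = 0" using val_mult[OF assms nz_inv[OF assms]] nz_r_inv[OF assms] by simp
  then show ?thesis by (simp add: eq_neg_iff_add_eq_0 add.commute)
qed

lemma val_inv_eqI: "\<lbrakk>a \<in> nz; b + v a = 0\<rbrakk> \<Longrightarrow> b = v (inv a)"
  using val_inv[of a] by (simp add: eq_neg_iff_add_eq_0[THEN iffD2])

lemma val_pow: "a \<in> nz \<Longrightarrow> v (a [^] Suc n) = v (a [^] n) + v a"
  using val_mult[of "a [^] n" a] nz_pow[of a n] by simp

lemma val_minus: assumes "a \<in> nz" shows "v (\<ominus> a) = v a"
proof -
  have m: "\<ominus> \<one> \<in> nz" using nz_minus[of \<one>] by simp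
  have "v (\<ominus> \<one>) + v (\<ominus> \<one>) = 0"
    using val_mult[OF m m] by (simp add: l_minus)
  \<comment> \<open>An ordered abelian group has no 2-torsion.\<close>
  then have "v (\<ominus> \<one>) = 0" by simp
  moreover have "\<ominus> a = \<ominus> \<one> \<otimes> a" using assms by (simp add: l_minus)
  ultimately show ?thesis using val_mult[OF m assms] by simp
qed

lemma val_add_strict:
  assumes "a \<in> nz" "b \<in> nz" "v a < v b"
  shows "a \<oplus> b \<in> nz" "v (a \<oplus> b) = v a"
proof -
  have ne: "a \<oplus> b \<noteq> \<zero>"
  proof
    assume "a \<oplus> b = \<zero>"
    then have "a = \<ominus> b" using assms minus_equality by auto
    then show False using val_minus[of b] assms by simp
  qed
  then show n: "a \<oplus> b \<in> nz" using assms by simp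
  have "v a \<le> v (a \<oplus> b)" using val_add[OF assms(1,2) ne] assms by auto
  moreover have "\<not> v a < v (a \<oplus> b)"
  proof
    assume l: "v a < v (a \<oplus> b)"
    have "a = (a \<oplus> b) \<oplus> \<ominus> b" using assms by (simp add: a_assoc r_neg)
    then have "min (v (a \<oplus> b)) (v (\<ominus> b)) \<le> v a"
      using val_add[OF n nz_minus[OF assms(2)]] assms by auto
    then show False using l assms(3) val_minus[OF assms(2)] by (auto simp: min_le_iff_disj)
  qed
  ultimately show "v (a \<oplus> b) = v a" by simp
qed

abbreviation "\<O> \<equiv> {a \<in> carrier L. a = \<zero> \<or> 0 \<le> v a}"
abbreviation "\<M> \<equiv> val_ideal L v"

lemma subring_O: "subring \<O> L"
proof (rule subringI)
  fix h assume "h \<in> \<O>" then show "\<ominus> h \<in> \<O>" using val_minus[of h] by (cases "h = \<zero>") auto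
next
  fix a b assume ab: "a \<in> \<O>" "b \<in> \<O>"
  show "a \<otimes> b \<in> \<O>" using ab val_mult[of a b] by (cases "a = \<zero>"; cases "b = \<zero>") auto
  show "a \<oplus> b \<in> \<O>"
  proof (cases "a = \<zero> \<or> b = \<zero> \<or> a \<oplus> b = \<zero>")
    case False
    then have "min (v a) (v b) \<le> v (a \<oplus> b)" "0 \<le> min (v a) (v b)" using ab val_add[of a b] by auto
    then have "0 \<le> v (a \<oplus> b)" by (rule order_trans[rotated])
    then show ?thesis using ab by simp
  qed (use ab in auto)
qed auto

lemma val_ring_simps [simp]:
  "carrier (val_ring L v) = \<O>" "\<zero>\<^bsub>val_ring L v\<^esub> = \<zero>" "\<one>\<^bsub>val_ring L v\<^esub> = \<one>"
  "x \<otimes>\<^bsub>val_ring L v\<^esub> y = x \<otimes> y" "x \<oplus>\<^bsub>val_ring L v\<^esub> y = x \<oplus> y"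
  by (auto simp: val_ring_def)

lemma cring_val_ring: "cring (val_ring L v)"
proof -
  have "subcring \<O> L" using subcringI'[OF subring_O] .
  then show ?thesis using subcring_iff[of \<O>] by (auto simp: val_ring_def)
qed

lemma ideal_M: "ideal \<M> (val_ring L v)"
proof (rule idealI)
  interpret V: cring "val_ring L v" by (rule cring_val_ring)
  show "ring (val_ring L v)" ..
  show "subgroup \<M> (add_monoid (val_ring L v))"
  proof (rule V.add.subgroupI)
    show "\<M> \<subseteq> carrier (val_ring L v)" by (auto simp: val_ideal_def)
    show "\<M> \<noteq> {}" by (auto simp: val_ideal_def)
  next
    fix a b assume ab: "a \<in> \<M>" "b \<in> \<M>"
    have "a \<oplus> b \<in> \<M>"
    proof (cases "a = \<zero> \<or> b = \<zero> \<or> a \<oplus> b = \<zero>")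
      case False
      then have "min (v a) (v b) \<le> v (a \<oplus> b)" "0 < min (v a) (v b)"
        using ab val_add[of a b] by (auto simp: val_ideal_def)
      then have "0 < v (a \<oplus> b)" by (rule less_le_trans[rotated])
      then show ?thesis using ab by (simp add: val_ideal_def)
    qed (use ab in \<open>auto simp: val_ideal_def\<close>)
    then show "a \<oplus>\<^bsub>val_ring L v\<^esub> b \<in> \<M>" by simp
  next
    fix a assume a: "a \<in> \<M>"
    then have "a \<in> \<O>" by (auto simp: val_ideal_def)
    then have "\<ominus>\<^bsub>val_ring L v\<^esub> a = \<ominus> a"
      using V.minus_equality[of "\<ominus> a" a] subringE(5)[OF subring_O, of a] by (simp add: l_neg)
    then show "\<ominus>\<^bsub>val_ring L v\<^esub> a \<in> \<M>" using a val_minus[of a]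
      by (cases "a = \<zero>") (auto simp: val_ideal_def)
  qed
  fix a x assume ax: "a \<in> \<M>" "x \<in> carrier (val_ring L v)"
  have "x \<otimes> a \<in> \<M>"
  proof (cases "a = \<zero> \<or> x = \<zero>")
    case False
    then have *: "x \<in> nz" "a \<in> nz" "0 \<le> v x" "0 < v a" using ax by (auto simp: val_ideal_def)
    then have "0 < v (x \<otimes> a)" using val_mult[OF *(1,2)] add_nonneg_pos[OF *(3,4)] by simp
    then show ?thesis using * by (simp add: val_ideal_def)
  qed (use ax in \<open>auto simp: val_ideal_def\<close>)
  then show "x \<otimes>\<^bsub>val_ring L v\<^esub> a \<in> \<M>" "a \<otimes>\<^bsub>val_ring L v\<^esub> x \<in> \<M>"
    using ax by (auto simp: m_comm val_ideal_def)
qed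

text \<open>An element of \<open>\<O>\<close> outside \<open>\<M>\<close> has value zero, so its
  inverse lies in \<open>\<O>\<close> too and any ideal containing it is everything.\<close>

lemma maximal_M: "maximalideal \<M> (val_ring L v)"
proof (rule maximalidealI[OF ideal_M])
  show "carrier (val_ring L v) \<noteq> \<M>"
  proof
    assume "carrier (val_ring L v) = \<M>"
    moreover have "\<one> \<in> carrier (val_ring L v)" by simp
    ultimately have "\<one> \<in> \<M>" by (rule subst)
    then show False by (simp add: val_ideal_def)
  qed
  fix J assume J: "ideal J (val_ring L v)" "\<M> \<subseteq> J" "J \<subseteq> carrier (val_ring L v)"
  interpret J: ideal J "val_ring L v" by fact
  show "J = \<M> \<or> J = carrier (val_ring L v)"
  proof (cases "J \<subseteq> \<M>")
    case False
    then obtain a where a: "a \<in> J" "a \<notin> \<M>" by auto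
    then have an: "a \<in> nz" "v a = 0" using J(3) by (auto simp: val_ideal_def)
    then have "inv a \<in> \<O>" using nz_inv[of a] val_inv[of a] by auto
    then have "\<one> \<in> J" using J.I_l_closed[OF a(1), of "inv a"] an(1) by simp
    then show ?thesis using J.one_imp_carrier by simp
  qed (use J in auto)
qed

section \<open>The residue map and the units of the valuation ring\<close>

abbreviation "F \<equiv> residue_field L v"

lemma field_F: "field F"
  unfolding residue_field_def by (rule maximalideal.quotient_is_field[OF maximal_M cring_val_ring])

definition "res a = \<M> +>\<^bsub>val_ring L v\<^esub> a"

lemma res_ring_hom: "ring_hom_ring (val_ring L v) F res"
  using ideal.rcos_ring_hom_ring[OF ideal_M] by (simp add: residue_field_def res_def[abs_def])

lemma carrier_F: "carrier F = res ` \<O>"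
  by (auto simp: residue_field_def FactRing_def A_RCOSETS_def' res_def)

lemma res_zero_iff: "a \<in> \<O> \<Longrightarrow> res a = \<zero>\<^bsub>F\<^esub> \<longleftrightarrow> a \<in> \<M>"
proof -
  assume a: "a \<in> \<O>"
  interpret M: ideal \<M> "val_ring L v" by (rule ideal_M)
  have "\<zero>\<^bsub>F\<^esub> = \<M>" by (simp add: residue_field_def FactRing_def)
  then show ?thesis using a M.a_rcos_const[of a] M.a_rcos_self[of a] by (auto simp: res_def)
qed

end

sublocale valued_field \<subseteq> F: field F
  by (rule field_F)

sublocale valued_field \<subseteq> res: ring_hom_ring "val_ring L v" F res
  by (rule res_ring_hom)

context valued_field
begin

lemma res_closed: "a \<in> \<O> \<Longrightarrow> res a \<in> carrier F"
  using carrier_F by auto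

lemma res_mult: "\<lbrakk>a \<in> \<O>; b \<in> \<O>\<rbrakk> \<Longrightarrow> res (a \<otimes> b) = res a \<otimes>\<^bsub>F\<^esub> res b"
  using res.hom_mult[of a b] by simp

lemma res_add: "\<lbrakk>a \<in> \<O>; b \<in> \<O>\<rbrakk> \<Longrightarrow> res (a \<oplus> b) = res a \<oplus>\<^bsub>F\<^esub> res b"
  using res.hom_add[of a b] by simp

lemma res_one: "res \<one> = \<one>\<^bsub>F\<^esub>"
  using res.hom_one by simp

lemma res_zero: "res \<zero> = \<zero>\<^bsub>F\<^esub>"
  using res.hom_zero by simp

lemma O_closed: "\<zero> \<in> \<O>" "\<one> \<in> \<O>" "a \<in> \<O> \<Longrightarrow> \<ominus> a \<in> \<O>" "\<lbrakk>a \<in> \<O>; b \<in> \<O>\<rbrakk> \<Longrightarrow> a \<otimes> b \<in> \<O>"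
   "\<lbrakk>a \<in> \<O>; b \<in> \<O>\<rbrakk> \<Longrightarrow> a \<oplus> b \<in> \<O>"
  using subringE[OF subring_O] by auto

lemma res_minus: assumes "a \<in> \<O>" shows "res (\<ominus> a) = \<ominus>\<^bsub>F\<^esub> res a"
proof -
  have "res (\<ominus> a) \<oplus>\<^bsub>F\<^esub> res a = \<zero>\<^bsub>F\<^esub>"
    using res_add[OF O_closed(3)[OF assms] assms] assms res_zero by (simp add: l_neg)
  then show ?thesis
    using F.minus_equality[OF _ res_closed[OF assms] res_closed[OF O_closed(3)[OF assms]]] by simp
qed

lemma res_pow: "a \<in> \<O> \<Longrightarrow> a [^] (n::nat) \<in> \<O> \<and> res (a [^] n) = res a [^]\<^bsub>F\<^esub> n"
proof (induct n)
  case (Suc n)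
  then have p: "a [^] n \<in> \<O>" "res (a [^] n) = res a [^]\<^bsub>F\<^esub> n" by blast+
  show ?case
    using res_mult[OF p(1) Suc(2)] O_closed(4)[OF p(1) Suc(2)] p(2) by simp
qed (use res_one in auto)

definition "val_units = {u \<in> nz. v u = 0}"

lemma val_units_nz: "u \<in> val_units \<Longrightarrow> u \<in> nz"
  and val_units_O: "u \<in> val_units \<Longrightarrow> u \<in> \<O>"
  by (auto simp: val_units_def)

lemma val_units_mult: "\<lbrakk>a \<in> val_units; b \<in> val_units\<rbrakk> \<Longrightarrow> a \<otimes> b \<in> val_units"
  using val_mult[of a b] nz_mult[of a b] by (simp add: val_units_def)

lemma val_units_inv: "a \<in> val_units \<Longrightarrow> inv a \<in> val_units"
  using val_inv[of a] nz_inv[of a] by (simp add: val_units_def)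

lemma val_units_one: "\<one> \<in> val_units"
  by (simp add: val_units_def)

lemma val_units_pow: "a \<in> val_units \<Longrightarrow> a [^] (n::nat) \<in> val_units"
  by (induct n) (auto simp: val_units_one val_units_mult)

lemma val_units_iff: "a \<in> \<O> \<Longrightarrow> a \<in> val_units \<longleftrightarrow> res a \<noteq> \<zero>\<^bsub>F\<^esub>"
  using res_zero_iff by (auto simp: val_units_def val_ideal_def)

lemma res_nz: "a \<in> val_units \<Longrightarrow> res a \<in> carrier F - {\<zero>\<^bsub>F\<^esub>}"
  using val_units_iff[of a] val_units_O[of a] res_closed by auto

lemma res_inv: assumes "a \<in> val_units" shows "res (inv a) = inv\<^bsub>F\<^esub> res a"
proof -
  note i = val_units_O[OF val_units_inv[OF assms]] val_units_O[OF assms]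
  have "res (inv a) \<otimes>\<^bsub>F\<^esub> res a = \<one>\<^bsub>F\<^esub>"
    using res_mult[OF i] val_units_nz[OF assms] res_one by simp
  then show ?thesis using F.comm_inv_char[of "res a" "res (inv a)"] res_closed[OF i(1)] res_closed[OF i(2)]
    by (simp add: F.m_comm)
qed

lemma res_val_pos: assumes "a \<in> nz" "0 < v a" shows "a \<in> \<O>" "res a = \<zero>\<^bsub>F\<^esub>"
  using assms res_zero_iff[of a] by (auto simp: val_ideal_def)

lemma residue_subfield_eq: "residue_subfield L v K = res ` (K \<inter> \<O>)"
  by (simp add: residue_subfield_def res_def)

lemma subfield_residue:
  assumes "subfield K L" shows "subfield (residue_subfield L v K) F"
proof (rule F.subfieldI'[OF F.subringI])
  note K = subringE[OF subfieldE(1)[OF assms]] and KI = subfield_m_inv(1)[OF assms]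
  let ?k = "residue_subfield L v K"
  show "?k \<subseteq> carrier F" "\<one>\<^bsub>F\<^esub> \<in> ?k"
    using res_one K(3) O_closed res_closed by (auto simp: residue_subfield_eq image_iff intro: bexI[of _ \<one>])
  fix h assume "h \<in> ?k"
  then obtain a where a: "a \<in> K" "a \<in> \<O>" "h = res a" unfolding residue_subfield_eq by blast
  have "\<ominus> a \<in> K \<inter> \<O>" using K(5)[OF a(1)] O_closed(3)[OF a(2)] by blast
  then show "\<ominus>\<^bsub>F\<^esub> h \<in> ?k"
    unfolding residue_subfield_eq a(3) res_minus[OF a(2), symmetric] by (rule imageI)
next
  note K = subringE[OF subfieldE(1)[OF assms]] and KI = subfield_m_inv(1)[OF assms]
  let ?k = "residue_subfield L v K"
  fix a b assume "a \<in> ?k" "b \<in> ?k"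
  then obtain a' b' where a: "a' \<in> K" "a' \<in> \<O>" "a = res a'" and b: "b' \<in> K" "b' \<in> \<O>" "b = res b'"
    unfolding residue_subfield_eq by blast
  have "a' \<otimes> b' \<in> K \<inter> \<O>" "a' \<oplus> b' \<in> K \<inter> \<O>"
    using K(6,7)[OF a(1) b(1)] O_closed(4,5)[OF a(2) b(2)] by blast+
  then show "a \<otimes>\<^bsub>F\<^esub> b \<in> ?k" "a \<oplus>\<^bsub>F\<^esub> b \<in> ?k"
    unfolding residue_subfield_eq a(3) b(3) res_mult[OF a(2) b(2), symmetric] res_add[OF a(2) b(2), symmetric]
    by (blast intro: imageI)+
next
  note K = subringE[OF subfieldE(1)[OF assms]] and KI = subfield_m_inv(1)[OF assms]
  let ?k = "residue_subfield L v K"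
  fix h assume "h \<in> ?k - {\<zero>\<^bsub>F\<^esub>}"
  then obtain a where a: "a \<in> K" "a \<in> \<O>" "h = res a" "res a \<noteq> \<zero>\<^bsub>F\<^esub>"
    unfolding residue_subfield_eq by blast
  then have u: "a \<in> val_units" using val_units_iff by simp
  show "inv\<^bsub>F\<^esub> h \<in> ?k"
    unfolding residue_subfield_eq a(3) using res_inv[OF u, symmetric] KI(1)[of a] a val_units_nz[OF u] val_units_O[OF val_units_inv[OF u]]
    by blast
qed

end

subsection \<open>Elements of algebraic type\<close>

text \<open>Degrees are multiplicative in the tower from \<open>K\<close> through \<open>B\<close>
  to \<open>B(y)\<close>. Read backwards, an element transcendental over \<open>Kv\<close> stays
  transcendental over a finite extension of \<open>Kv\<close>.\<close>

lemma (in domain) algebraic_over_finite_extension: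
  assumes "subfield K R" "subfield B R" "finite_dimension K B" "y \<in> carrier R" "(algebraic over B) y"
  shows "(algebraic over K) y"
proof -
  have "finite_dimension B (simple_extension B y)"
    using finite_dimension_simple_extension assms by blast
  then have "finite_dimension K (simple_extension B y)"
    using telescopic_base_dim(1) assms by blast
  then show ?thesis
    using finite_dimension_imp_algebraic[OF assms(1)] simple_extension_is_subring[OF subfieldE(1)[OF assms(2)] assms(4)]
      simple_extension_mem[OF subfieldE(1)[OF assms(2)] assms(4)] by blast
qed

lemma (in domain) algebraic_root:
  assumes K: "subfield K R" and y: "y \<in> carrier R" and n: "n > 0" and a: "(algebraic over K) (y [^] (n::nat))"
  shows "(algebraic over K) y"
proof -
  define a where "a = y [^] n"
  define B where "B = simple_extension K a"
  have ac: "a \<in> carrier R" using y by (simp add: a_def)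
  have B: "subfield B R" "finite_dimension K B" "a \<in> B"
    using simple_extension_is_subfield[OF K ac] finite_dimension_simple_extension[OF K ac]
      simple_extension_mem[OF subfieldE(1)[OF K] ac] a unfolding B_def a_def by auto
  note Br = subringE[OF subfieldE(1)[OF B(1)]]
  \<comment> \<open>Coefficient lists start with the leading term, so this is
    \<open>X^n - a\<close>, a polynomial over \<open>B = K(a)\<close>.\<close>
  define p where "p = \<one> # (replicate (n - 1) \<zero> @ [\<ominus> a])"
  have ev: "eval (replicate k \<zero> @ [\<ominus> a]) y = \<ominus> a" for k
    using ac y by (induct k) auto
  have "eval p y = \<one> \<otimes> y [^] n \<oplus> \<ominus> a"
    using n unfolding p_def by (simp add: ev)
  then have "eval p y = \<zero>" using ac y by (simp add: a_def[symmetric] r_neg)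
  moreover have "p \<in> carrier (B[X])"
    unfolding univ_poly_def polynomial_def p_def using Br B(3) by auto
  ultimately have "(algebraic over B) y" using algebraicI[of p B y] by (simp add: p_def)
  then show ?thesis using algebraic_over_finite_extension[OF K B(1,2) y] by blast
qed

locale valued_field_extension = valued_field L v
  for L :: "('a, 'b) ring_scheme" (structure) and v :: "'a \<Rightarrow> 'g::linordered_ab_group_add" +
  fixes K :: "'a set"
  assumes K: "subfield K L"
begin

lemmas K_ring = subringE[OF subfieldE(1)[OF K]]

abbreviation "Knz \<equiv> K - {\<zero>}"
abbreviation "Kv \<equiv> residue_subfield L v K"

lemma Knz_nz: "c \<in> Knz \<Longrightarrow> c \<in> nz"
  using K_ring(1) by blast

lemma Knz_inv: "c \<in> Knz \<Longrightarrow> inv c \<in> Knz"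
  using subfield_m_inv(1)[OF K] by blast

lemma Knz_mult: "\<lbrakk>c \<in> Knz; d \<in> Knz\<rbrakk> \<Longrightarrow> c \<otimes> d \<in> Knz"
  using K_ring(6)[of c d] nz_mult[OF Knz_nz Knz_nz, of c d] by blast

lemma Knz_pow: "c \<in> Knz \<Longrightarrow> c [^] (n::nat) \<in> Knz"
proof (induct n)
  case 0 then show ?case using K_ring(3) by simp
next
  case (Suc n) then show ?case using Knz_mult[of "c [^] n" c] by simp
qed

lemma Kv: "subfield Kv F"
  by (rule subfield_residue[OF K])

text \<open>The relative algebraic closure of \<open>Kv\<close> in the residue field. That it is a
  subfield and contains all roots of its elements is what algebraic type rests on.\<close>

definition "algs = {y \<in> carrier F. (F.algebraic over Kv) y}"

lemma algs: "subfield algs F"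
  unfolding algs_def by (rule F.subfield_of_algebraics[OF Kv])

lemma Kv_algs: "Kv \<subseteq> algs"
  using F.algebraic_self[OF subfieldE(1)[OF Kv]] subfieldE(3)[OF Kv] unfolding algs_def by blast

lemmas algs_ring = subringE[OF subfieldE(1)[OF algs]]

lemma algs_root: "\<lbrakk>y \<in> carrier F; n > 0; y [^]\<^bsub>F\<^esub> (n::nat) \<in> algs\<rbrakk> \<Longrightarrow> y \<in> algs"
  using F.algebraic_root[OF Kv] unfolding algs_def by blast

definition "alg_units = {u \<in> val_units. res u \<in> algs}"

text \<open>This is the group \<open>1 + \<M>\<close>. In terms of residues, closure under products
  and inverses is immediate from multiplicativity of \<open>res\<close>.\<close>

definition "one_units = {u \<in> val_units. res u = \<one>\<^bsub>F\<^esub>}"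

lemma alg_units_one: "\<one> \<in> alg_units"
  using val_units_one res_one algs_ring(3) by (simp add: alg_units_def)

lemma alg_units_mult: assumes "a \<in> alg_units" "b \<in> alg_units" shows "a \<otimes> b \<in> alg_units"
  using assms val_units_mult[of a b] res_mult[OF val_units_O val_units_O, of a b] algs_ring(6)
  by (simp add: alg_units_def)

lemma alg_units_inv: assumes "a \<in> alg_units" shows "inv a \<in> alg_units"
  using assms val_units_inv[of a] res_inv[of a] res_nz[of a] F.subfield_m_inv(1)[OF algs, of "res a"]
  by (simp add: alg_units_def)

lemma alg_units_pow: assumes "a \<in> alg_units" shows "a [^] (n::nat) \<in> alg_units"
  by (induct n) (use assms alg_units_one alg_units_mult in auto)

lemma one_units_alg: "one_units \<subseteq> alg_units"
  using algs_ring(3) by (auto simp: one_units_def alg_units_def)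

lemma K_alg_units: assumes "c \<in> Knz" "v c = 0" shows "c \<in> alg_units"
proof -
  have "c \<in> val_units" using assms Knz_nz by (simp add: val_units_def)
  moreover have "res c \<in> Kv" unfolding residue_subfield_eq using assms Knz_nz[OF assms(1)] by (intro imageI) simp
  ultimately show ?thesis using Kv_algs by (auto simp: alg_units_def)
qed

lemma one_units_mult: "\<lbrakk>a \<in> one_units; b \<in> one_units\<rbrakk> \<Longrightarrow> a \<otimes> b \<in> one_units"
  using val_units_mult[of a b] res_mult[OF val_units_O val_units_O, of a b]
  by (simp add: one_units_def)

lemma one_units_inv: "a \<in> one_units \<Longrightarrow> inv a \<in> one_units"
  using val_units_inv[of a] res_inv[of a] by (simp add: one_units_def)

lemma one_units_one: "\<one> \<in> one_units"
  using val_units_one res_one by (simp add: one_units_def)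

lemma one_units_nz: "u \<in> one_units \<Longrightarrow> u \<in> nz"
  by (simp add: one_units_def val_units_def)

lemma val_one_units: "u \<in> one_units \<Longrightarrow> v u = 0"
  by (simp add: one_units_def val_units_def)

lemma alg_units_nz: "u \<in> alg_units \<Longrightarrow> u \<in> nz"
  by (simp add: alg_units_def val_units_def)

lemma one_unitsI: assumes "z \<in> nz" "0 < v z" shows "\<one> \<oplus> z \<in> one_units"
proof -
  have n: "\<one> \<oplus> z \<in> nz" "v (\<one> \<oplus> z) = 0" using val_add_strict[of \<one> z] assms by auto
  moreover have "res (\<one> \<oplus> z) = \<one>\<^bsub>F\<^esub>"
    using res_add[OF O_closed(2) res_val_pos(1)[OF assms]] res_val_pos(2)[OF assms] res_one by simp
  ultimately show ?thesis by (simp add: one_units_def val_units_def)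
qed

text \<open>Admitting powers makes the class closed under roots, and admitting constants
  \<open>c\<close> puts all nonzero elements of \<open>K\<close> into it. It is a subgroup of the
  multiplicative group of \<open>L\<close>, but not closed under addition; sums are controlled only
  through \<open>sum_not_alg_type\<close>.\<close>

definition "alg_type = {r \<in> nz. \<exists>n>0. \<exists>c \<in> Knz. r [^] (n::nat) \<otimes> c \<in> alg_units}"

lemma alg_type_nz: "r \<in> alg_type \<Longrightarrow> r \<in> nz"
  by (simp add: alg_type_def)

lemma alg_units_type: "u \<in> alg_units \<Longrightarrow> u \<in> alg_type"
  using alg_units_nz[of u] K_ring(3) by (auto simp: alg_type_def intro!: exI[of _ 1] bexI[of _ \<one>])

lemma Knz_alg_type: assumes "c \<in> Knz" shows "c \<in> alg_type"
proof -
  have "c [^] (1::nat) \<otimes> inv c \<in> alg_units"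
    using Knz_nz[OF assms] alg_units_one by simp
  then show ?thesis using Knz_inv[OF assms] Knz_nz[OF assms] unfolding alg_type_def by blast
qed

lemma alg_type_mult: assumes "r \<in> alg_type" "s \<in> alg_type" shows "r \<otimes> s \<in> alg_type"
proof -
  obtain n c m d where n: "n > (0::nat)" "c \<in> Knz" "r [^] n \<otimes> c \<in> alg_units"
    and m: "m > (0::nat)" "d \<in> Knz" "s [^] m \<otimes> d \<in> alg_units"
    using assms unfolding alg_type_def by blast
  have cr: "r \<in> carrier L" "s \<in> carrier L" "c \<in> carrier L" "d \<in> carrier L"
    using alg_type_nz assms Knz_nz n m by blast+
  have "(r [^] n \<otimes> c) [^] m \<otimes> (s [^] m \<otimes> d) [^] n \<in> alg_units"
    using n m alg_units_pow alg_units_mult by blast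
  also have "(r [^] n \<otimes> c) [^] m \<otimes> (s [^] m \<otimes> d) [^] n
     = (r [^] (n * m) \<otimes> c [^] m) \<otimes> (s [^] (m * n) \<otimes> d [^] n)"
    using cr by (simp add: nat_pow_distrib nat_pow_pow)
  also have "\<dots> = (r \<otimes> s) [^] (n * m) \<otimes> (c [^] m \<otimes> d [^] n)"
    using cr by (simp add: nat_pow_distrib mult.commute[of m n] m_ac)
  finally have "(r \<otimes> s) [^] (n * m) \<otimes> (c [^] m \<otimes> d [^] n) \<in> alg_units" .
  moreover have "c [^] m \<otimes> d [^] n \<in> Knz" using Knz_mult Knz_pow n m by blast
  moreover have "r \<otimes> s \<in> nz" using nz_mult alg_type_nz assms by blast
  moreover have "n * m > 0" using n m by simp
  ultimately show ?thesis unfolding alg_type_def by blast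
qed

lemma alg_type_inv: assumes "r \<in> alg_type" shows "inv r \<in> alg_type"
proof -
  obtain n c where n: "n > (0::nat)" "c \<in> Knz" "r [^] n \<otimes> c \<in> alg_units"
    using assms unfolding alg_type_def by blast
  have rn: "r \<in> nz" using alg_type_nz assms by blast
  have "inv (r [^] n \<otimes> c) = inv r [^] n \<otimes> inv c"
    using inv_mult_nz[OF nz_pow[OF rn] Knz_nz[OF n(2)]] inv_pow_nz[OF rn] by simp
  then have "inv r [^] n \<otimes> inv c \<in> alg_units" using alg_units_inv n by metis
  then show ?thesis using n Knz_inv[OF n(2)] nz_inv[OF rn] unfolding alg_type_def by blast
qed

lemma alg_type_root: assumes "r \<in> nz" "k > 0" "r [^] (k::nat) \<in> alg_type" shows "r \<in> alg_type"
proof -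
  obtain n c where n: "n > (0::nat)" "c \<in> Knz" "(r [^] k) [^] n \<otimes> c \<in> alg_units"
    using assms unfolding alg_type_def by blast
  then have "r [^] (k * n) \<otimes> c \<in> alg_units" "k * n > 0" using assms by (auto simp: nat_pow_pow)
  then show ?thesis using n assms unfolding alg_type_def by blast
qed

text \<open>If \<open>v r = 0\<close>, the scaling constant has value zero as well and can be
  divided out. A power of \<open>res r\<close> is then algebraic, and \<open>algs\<close> contains
  roots. This is the passage from algebraic type back to residues.\<close>

lemma alg_type_unit: assumes "r \<in> alg_type" "v r = 0" shows "r \<in> alg_units"
proof -
  obtain n c where n: "n > (0::nat)" "c \<in> Knz" "r [^] n \<otimes> c \<in> alg_units"
    using assms unfolding alg_type_def by blast
  have r: "r \<in> val_units" using assms alg_type_nz by (simp add: val_units_def)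
  then have rn: "r [^] n \<in> val_units" by (rule val_units_pow)
  have "v (r [^] n \<otimes> c) = v c" using val_mult[OF val_units_nz[OF rn] Knz_nz[OF n(2)]] rn by (simp add: val_units_def)
  then have "v c = 0" using n(3) by (simp add: alg_units_def val_units_def)
  then have "inv c \<in> alg_units" using K_alg_units n alg_units_inv by blast
  then have "(r [^] n \<otimes> c) \<otimes> inv c \<in> alg_units" using n alg_units_mult by blast
  then have "r [^] n \<in> alg_units" using mult_inv_cancel(2)[OF _ Knz_nz[OF n(2)]] val_units_nz[OF rn] by simp
  then have "res r [^]\<^bsub>F\<^esub> n \<in> algs" using res_pow[OF val_units_O[OF r], of n] by (simp add: alg_units_def)
  then have "res r \<in> algs" using algs_root[of "res r" n] res_nz[OF r] n by blast
  then show ?thesis using r by (simp add: alg_units_def)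
qed

lemma alg_type_torsion:
  assumes "r \<in> alg_type" obtains n c where "n > (0::nat)" "c \<in> Knz" "v (r [^] n) = v c"
proof -
  obtain n c where n: "n > (0::nat)" "c \<in> Knz" "r [^] n \<otimes> c \<in> alg_units"
    using assms unfolding alg_type_def by blast
  have "v (r [^] n) + v c = 0"
    using n val_mult[OF nz_pow[OF alg_type_nz[OF assms]] Knz_nz[OF n(2)]] by (simp add: alg_units_def val_units_def)
  then have "v (r [^] n) = v (inv c)" using val_inv[OF Knz_nz[OF n(2)]] eq_neg_iff_add_eq_0[THEN iffD2] by simp
  then show ?thesis using that n Knz_inv by blast
qed

text \<open>It suffices that \<open>v z > 0\<close>. If \<open>v z < 0\<close>, then
  \<open>1 + 1/z\<close> is a 1-unit and \<open>z = (1 + z) / (1 + 1/z)\<close> is of algebraic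
  type. If \<open>v z = 0\<close>, then \<open>res z = res (1 + z) - 1\<close> is algebraic, and
  again \<open>z\<close> is of algebraic type.\<close>

lemma one_plus_not_alg_type:
  assumes z: "z \<in> nz" "z \<notin> alg_type" and r: "\<one> \<oplus> z \<in> alg_type"
  shows "\<one> \<oplus> z \<in> one_units"
proof -
  have "0 < v z"
  proof (rule ccontr)
    assume "\<not> 0 < v z"
    then consider "v z < 0" | "v z = 0" by fastforce
    then show False
    proof cases
      case 1
      then have "\<one> \<oplus> inv z \<in> one_units" using one_unitsI[of "inv z"] nz_inv[OF z(1)] val_inv[OF z(1)] by simp
      then have t: "\<one> \<oplus> inv z \<in> alg_type" using one_units_alg alg_units_type by blast
      have "z \<otimes> (\<one> \<oplus> inv z) = \<one> \<oplus> z"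
        using z nz_inv[OF z(1)] by (simp add: r_distr a_comm)
      then have "z = (\<one> \<oplus> z) \<otimes> inv (\<one> \<oplus> inv z)"
        using mult_inv_cancel(2)[of z "\<one> \<oplus> inv z"] z alg_type_nz[OF t] by simp
      then show False using alg_type_mult[OF r alg_type_inv[OF t]] z by simp
    next
      case 2
      then have zu: "z \<in> val_units" using z by (simp add: val_units_def)
      note zO = val_units_O[OF zu]
      have s: "\<one> \<oplus> z \<in> \<O>" using O_closed(5)[OF O_closed(2) zO] .
      \<comment> \<open>The sum may have positive value; its residue is then zero, which is
        algebraic too.\<close>
      have "res (\<one> \<oplus> z) \<in> algs"
      proof (cases "\<one> \<oplus> z \<in> val_units")
        case True then show ?thesis using alg_type_unit[OF r] by (simp add: alg_units_def val_units_def)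
      next
        case False then show ?thesis using val_units_iff[OF s] algs_ring(2) by simp
      qed
      moreover have "res (\<one> \<oplus> z) = \<one>\<^bsub>F\<^esub> \<oplus>\<^bsub>F\<^esub> res z" using res_add[OF O_closed(2) zO] res_one by simp
      ultimately have "\<ominus>\<^bsub>F\<^esub> \<one>\<^bsub>F\<^esub> \<oplus>\<^bsub>F\<^esub> (\<one>\<^bsub>F\<^esub> \<oplus>\<^bsub>F\<^esub> res z) \<in> algs"
        using algs_ring(3,5,7) by simp
      moreover have "\<ominus>\<^bsub>F\<^esub> \<one>\<^bsub>F\<^esub> \<oplus>\<^bsub>F\<^esub> (\<one>\<^bsub>F\<^esub> \<oplus>\<^bsub>F\<^esub> res z) = res z"
        using res_closed[OF zO] by (simp add: F.r_neg1)
      ultimately have "z \<in> alg_units" using zu by (simp add: alg_units_def)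
      then show False using alg_units_type z by blast
    qed
  qed
  then show ?thesis using one_unitsI z by blast
qed

text \<open>Division by \<open>r\<close> reduces this to \<open>r = 1\<close>. It is the principle
  that \<open>Q\<close> cannot cancel: in the applications \<open>r\<close> is a polynomial of
  degree below \<open>d\<close>, and \<open>z\<close> is \<open>Q\<close> or a multiple of
  it.\<close>

lemma sum_not_alg_type:
  assumes "r \<in> alg_type" "z \<in> nz" "z \<notin> alg_type" "r \<oplus> z \<in> alg_type"
  shows "\<exists>u \<in> one_units. r \<oplus> z = u \<otimes> r"
proof -
  note rn = alg_type_nz[OF assms(1)] and sn = alg_type_nz[OF assms(4)]
  note irn = nz_inv[OF rn]
  define w where "w = z \<otimes> inv r"
  have wn: "w \<in> nz" unfolding w_def using nz_mult assms irn by blast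
  have zw: "w \<otimes> r = z" unfolding w_def using mult_inv_cancel(1) assms rn by blast
  have eq: "r \<oplus> z = (\<one> \<oplus> w) \<otimes> r" using zw rn wn by (simp add: l_distr)
  then have "\<one> \<oplus> w = (r \<oplus> z) \<otimes> inv r" using mult_inv_cancel(2)[of "\<one> \<oplus> w" r] rn wn by simp
  then have "\<one> \<oplus> w \<in> alg_type" using alg_type_mult[OF assms(4) alg_type_inv[OF assms(1)]] by simp
  moreover have "w \<notin> alg_type" using alg_type_mult[of w r] assms zw by auto
  ultimately have "\<one> \<oplus> w \<in> one_units" using one_plus_not_alg_type wn by blast
  then show ?thesis using eq by blast
qed

end

subsection \<open>Values and residues of finite-dimensional subspaces\<close>

declare (in ring) Span.simps [simp del]

lemma (in ring) Span_Cons: "Span K (u # us) = line_extension K u (Span K us)"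
  and Span_Nil: "Span K [] = {\<zero>}"
  by (simp_all add: Span.simps)

text \<open>Serves two exchange arguments: lists of independent vectors have length bounded by a
  dimension, and a value or residue that is still missing would allow a longer list.\<close>

lemma maximal_list:
  assumes "P []" and "\<And>us. P us \<Longrightarrow> length us \<le> (n::nat)"
  obtains us where "P us" "\<And>u. \<not> P (u # us)"
proof -
  have "\<exists>us. P us \<and> (\<forall>ws. P ws \<longrightarrow> length ws \<le> length us)"
    by (rule ex_has_greatest_nat[of P "[]" length "Suc n"]) (use assms in \<open>auto intro: le_imp_less_Suc\<close>)
  then obtain us where us: "P us" "\<And>ws. P ws \<Longrightarrow> length ws \<le> length us" by auto
  have "\<not> P (u # us)" for u using us(2)[of "u # us"] by auto
  with us(1) that show thesis by blast
qed

context valued_field_extension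
begin

text \<open>Vectors with values in different cosets of \<open>vK\<close> cannot cancel. So an
  independent list whose span only takes values in the cosets of its members keeps this property
  when a vector with value in a new coset is added. A longest such list represents all cosets, and
  the dimension bounds its length.\<close>

lemma Span_values_finite:
  assumes Us: "set Us \<subseteq> carrier L"
  obtains S where "finite S" "S \<subseteq> Span K Us - {\<zero>}"
    "\<And>w. w \<in> Span K Us - {\<zero>} \<Longrightarrow> \<exists>s\<in>S. \<exists>c\<in>Knz. v w = v s + v c"
proof -
  let ?W = "Span K Us"
  define cov where "cov ws = {w. \<exists>s\<in>set ws. \<exists>c\<in>Knz. v w = v s + v c}" for ws
  obtain n where n: "dimension n K ?W" using Span_finite_dimension[OF K Us] by blast
  let ?P = "\<lambda>ws. set ws \<subseteq> ?W - {\<zero>} \<and> independent K ws \<and> Span K ws - {\<zero>} \<subseteq> cov ws"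
  have "?P []" by (simp add: Span_Nil)
  moreover have "length ws \<le> n" if "?P ws" for ws
    using independent_length_le_dimension[OF K n] that by blast
  ultimately obtain ws where ws: "?P ws" and max: "\<And>w. \<not> ?P (w # ws)"
    by (rule maximal_list) blast+
  have W: "?W \<subseteq> carrier L" using Span_subgroup_props(1)[OF K Us] .
  have wsc: "set ws \<subseteq> carrier L" using ws W by blast
  have "w \<in> cov ws" if w: "w \<in> ?W - {\<zero>}" for w
  proof (rule ccontr)
    assume nc: "w \<notin> cov ws"
    have wn: "w \<in> nz" using w W by blast
    have "w \<notin> Span K ws" using nc ws w by blast
    then have ind: "independent K (w # ws)" using li_Cons ws wn by blast
    have "y \<in> cov (w # ws)" if y: "y \<in> Span K (w # ws) - {\<zero>}" for y
    proof -
      obtain k z where kz: "k \<in> K" "z \<in> Span K ws" "y = k \<otimes> w \<oplus> z"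
        using y line_extension_mem_iff[of y K w "Span K ws"] unfolding Span_Cons by blast
      have zc: "z \<in> carrier L" using kz(2) Span_subgroup_props(1)[OF K wsc] by blast
      have covz: "z \<in> cov (w # ws)" if "z \<noteq> \<zero>" using that kz ws by (auto simp: cov_def)
      have eqv: "y' \<in> cov (w # ws)" if "v y' = v z" "z \<noteq> \<zero>" for y'
        using covz that by (auto simp: cov_def)
      show ?thesis
      proof (cases "k = \<zero>")
        case True then have "y = z" using kz wn zc by simp
        then show ?thesis using covz y by blast
      next
        case False
        then have k: "k \<in> Knz" using kz by blast
        have kw: "k \<otimes> w \<in> nz" "v (k \<otimes> w) = v w + v k"
          using nz_mult[OF Knz_nz[OF k] wn] val_mult[OF Knz_nz[OF k] wn] by (auto simp: add.commute)
        have covk: "y' \<in> cov (w # ws)" if "v y' = v (k \<otimes> w)" for y'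
          using that kw k by (auto simp: cov_def)
        show ?thesis
        proof (cases "z = \<zero>")
          case True then have "y = k \<otimes> w" using kz kw by simp
          then show ?thesis using covk by blast
        next
          case z: False
          \<comment> \<open>Here the new coset enters: equality would place \<open>v w\<close> in
            the coset of a member of \<open>ws\<close>.\<close>
          have "v z \<noteq> v (k \<otimes> w)"
          proof
            assume e: "v z = v (k \<otimes> w)"
            obtain s c where sc: "s \<in> set ws" "c \<in> Knz" "v z = v s + v c"
              using ws kz(2) z unfolding cov_def by blast
            have "v (c \<otimes> inv k) = v c - v k"
              using val_mult[OF Knz_nz[OF sc(2)] Knz_nz[OF Knz_inv[OF k]]] val_inv[OF Knz_nz[OF k]] by simp
            moreover have "v w + v k = v s + v c" using e sc(3) kw(2) by simp
            then have "v w = v s + v c - v k" by (simp add: eq_diff_eq)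
            ultimately have "v w = v s + v (c \<otimes> inv k)" by (simp add: add_diff_eq)
            then show False using nc sc Knz_mult[OF sc(2) Knz_inv[OF k]] by (auto simp: cov_def)
          qed
          then consider "v z < v (k \<otimes> w)" | "v (k \<otimes> w) < v z" by fastforce
          then show ?thesis
          proof cases
            case 1
            then have "v y = v z" using val_add_strict(2)[of z "k \<otimes> w"] kw(1) zc z kz(3) a_comm[of z "k \<otimes> w"] by simp
            then show ?thesis using eqv z by blast
          next
            case 2
            then have "v y = v (k \<otimes> w)" using val_add_strict(2)[of "k \<otimes> w" z] kw(1) zc z kz(3) by simp
            then show ?thesis using covk by blast
          qed
        qed
      qed
    qed
    then have "Span K (w # ws) - {\<zero>} \<subseteq> cov (w # ws)" by (rule subsetI)
    then show False using max[of w] ind ws w by simp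
  qed
  then show thesis using that[of "set ws"] ws unfolding cov_def by blast
qed

text \<open>Residues independent over \<open>Kv\<close> lift to vectors independent over
  \<open>K\<close>, so their number is at most the dimension of the space. The list also carries the
  condition that integral elements of its span have residues in the span of its residues; this is
  why a lift of a new residue lies outside the old span.\<close>

lemma Span_residues_finite_dimension:
  assumes Us: "set Us \<subseteq> carrier L"
  obtains Bs where "set Bs \<subseteq> carrier F" "F.independent Kv Bs" "F.Span Kv Bs = res ` (Span K Us \<inter> \<O>)"
proof -
  let ?W = "Span K Us"
  note Wp = Span_subgroup_props[OF K Us] Span_smult_closed[OF K Us]
  obtain n where n: "dimension n K ?W" using Span_finite_dimension[OF K Us] by blast
  let ?P = "\<lambda>us. set us \<subseteq> ?W \<inter> \<O> \<and> independent K us \<and> F.independent Kv (map res us) \<and>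
      res ` (Span K us \<inter> \<O>) \<subseteq> F.Span Kv (map res us)"
  have "?P []" using res_zero by (auto simp: Span_Nil F.Span_Nil)
  moreover have "length us \<le> n" if "?P us" for us
  proof (rule independent_length_le_dimension[OF K n])
    show "independent K us" "set us \<subseteq> ?W" using that by simp_all
  qed
  ultimately obtain us where us: "?P us" and max: "\<And>w. \<not> ?P (w # us)"
    by (rule maximal_list) blast+
  have usc: "set us \<subseteq> carrier L" using us by blast
  have rusc: "set (map res us) \<subseteq> carrier F" using us res_closed by auto
  note Sp = Span_subgroup_props[OF K usc] Span_smult_closed[OF K usc]
  note FSp = F.Span_subgroup_props[OF Kv rusc] F.Span_smult_closed[OF Kv rusc]
  have sub: "res w \<in> F.Span Kv (map res us)" if w: "w \<in> ?W" "w \<in> \<O>" for w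
  proof (rule ccontr)
    assume nr: "res w \<notin> F.Span Kv (map res us)"
    have wc: "w \<in> carrier L" using w by blast
    have "w \<notin> Span K us" using nr us w by blast
    then have i1: "independent K (w # us)" using li_Cons us wc by blast
    have i2: "F.independent Kv (map res (w # us))"
      using F.li_Cons[OF res_closed[OF w(2)] nr] us by simp
    have "res y \<in> F.Span Kv (map res (w # us))" if y: "y \<in> Span K (w # us)" "y \<in> \<O>" for y
    proof -
      obtain k z where kz: "k \<in> K" "z \<in> Span K us" "y = k \<otimes> w \<oplus> z"
        using y unfolding Span_Cons line_extension_mem_iff by blast
      have zc: "z \<in> carrier L" using kz(2) Sp(1) by blast
      have kc: "k \<in> carrier L" using kz(1) K_ring(1) by blast
      show ?thesis
      proof (cases "k \<in> \<O>")
        case True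
        have kwO: "k \<otimes> w \<in> \<O>" using O_closed(4)[OF True w(2)] .
        have "z = y \<oplus> \<ominus> (k \<otimes> w)" unfolding kz(3) using zc kc wc by algebra
        then have zO: "z \<in> \<O>" using O_closed(5)[OF y(2) O_closed(3)[OF kwO]] by simp
        have "res y = res k \<otimes>\<^bsub>F\<^esub> res w \<oplus>\<^bsub>F\<^esub> res z"
          unfolding kz(3) res_add[OF kwO zO] res_mult[OF True w(2)] ..
        moreover have "res k \<in> Kv" unfolding residue_subfield_eq using True kz(1) by (intro imageI) blast
        moreover have "res z \<in> F.Span Kv (map res us)" using us kz(2) zO by blast
        ultimately show ?thesis unfolding list.map F.Span_Cons F.line_extension_mem_iff by blast
      next
        case False
        then have k: "k \<in> Knz" "v k < 0" using kz(1) kc by auto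
        have kn: "k \<in> nz" and ikn: "inv k \<in> nz" using k Knz_nz nz_inv by blast+
        have ikc: "inv k \<in> carrier L" using ikn by blast
        \<comment> \<open>A coefficient outside \<open>\<O>\<close> leads to a contradiction: after
          division by \<open>k\<close> the element \<open>y\<close> gets residue zero, and
          \<open>res w\<close> falls into the span of the old residues.\<close>
        have pos: "0 < v (inv k)" using val_inv[OF kn] k by simp
        have e: "inv k \<otimes> y = w \<oplus> inv k \<otimes> z"
        proof -
          have "inv k \<otimes> y = (inv k \<otimes> k) \<otimes> w \<oplus> inv k \<otimes> z" unfolding kz(3) using ikc kc wc zc by algebra
          then show ?thesis using kn wc by simp
        qed
        have yM: "inv k \<otimes> y \<in> \<O>" "res (inv k \<otimes> y) = \<zero>\<^bsub>F\<^esub>"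
        proof -
          show "inv k \<otimes> y \<in> \<O>" using O_closed(4)[OF res_val_pos(1)[OF ikn pos] y(2)] .
          show "res (inv k \<otimes> y) = \<zero>\<^bsub>F\<^esub>"
            using res_mult[OF res_val_pos(1)[OF ikn pos] y(2)] res_val_pos(2)[OF ikn pos] res_closed[OF y(2)] by simp
        qed
        have "inv k \<otimes> z = inv k \<otimes> y \<oplus> \<ominus> w" unfolding e using ikc zc wc by algebra
        then have zO: "inv k \<otimes> z \<in> \<O>" using O_closed(5)[OF yM(1) O_closed(3)[OF w(2)]] by simp
        have "w = inv k \<otimes> y \<oplus> \<ominus> (inv k \<otimes> z)" unfolding e using ikc zc wc by algebra
        then have "res w = res (inv k \<otimes> y) \<oplus>\<^bsub>F\<^esub> res (\<ominus> (inv k \<otimes> z))"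
          using res_add[OF yM(1) O_closed(3)[OF zO]] by simp
        also have "\<dots> = \<ominus>\<^bsub>F\<^esub> res (inv k \<otimes> z)"
          using yM res_minus[OF zO] res_closed[OF zO] by simp
        also have "\<dots> \<in> F.Span Kv (map res us)"
        proof (rule FSp(4))
          have "inv k \<otimes> z \<in> Span K us" using Sp(5) Knz_inv[OF k(1)] kz(2) by blast
          then show "res (inv k \<otimes> z) \<in> F.Span Kv (map res us)" using us zO by blast
        qed
        finally show ?thesis using nr by blast
      qed
    qed
    then have "res ` (Span K (w # us) \<inter> \<O>) \<subseteq> F.Span Kv (map res (w # us))" by blast
    then show False using max[of w] i1 i2 us w by simp
  qed
  \<comment> \<open>A \<open>subalgebra\<close> over \<open>Kv\<close> is here a
    \<open>Kv\<close>-subspace: closed under addition and scalars, with no condition on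
    products.\<close>
  have "subalgebra Kv (res ` (?W \<inter> \<O>)) F"
  proof (intro subalgebra.intro F.add.subgroupI subalgebra_axioms.intro)
    show "res ` (?W \<inter> \<O>) \<subseteq> carrier F" using res_closed by blast
    show "res ` (?W \<inter> \<O>) \<noteq> {}" using Wp(2) O_closed(1) by blast
  next
    fix a assume "a \<in> res ` (?W \<inter> \<O>)"
    then obtain a' where a: "a' \<in> ?W" "a' \<in> \<O>" "a = res a'" by blast
    show "\<ominus>\<^bsub>F\<^esub> a \<in> res ` (?W \<inter> \<O>)"
      unfolding a(3) res_minus[OF a(2), symmetric] using Wp(4)[OF a(1)] O_closed(3)[OF a(2)] by (intro imageI IntI)
  next
    fix a b assume "a \<in> res ` (?W \<inter> \<O>)" "b \<in> res ` (?W \<inter> \<O>)"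
    then obtain a' b' where a: "a' \<in> ?W" "a' \<in> \<O>" "a = res a'" and b: "b' \<in> ?W" "b' \<in> \<O>" "b = res b'" by blast
    show "a \<oplus>\<^bsub>F\<^esub> b \<in> res ` (?W \<inter> \<O>)"
      unfolding a(3) b(3) res_add[OF a(2) b(2), symmetric] using Wp(3)[OF a(1) b(1)] O_closed(5)[OF a(2) b(2)] by (intro imageI IntI)
  next
    fix k a assume "k \<in> Kv" "a \<in> res ` (?W \<inter> \<O>)"
    then obtain k' a' where a: "a' \<in> ?W" "a' \<in> \<O>" "a = res a'" and k: "k' \<in> K" "k' \<in> \<O>" "k = res k'"
      unfolding residue_subfield_eq by blast
    show "k \<otimes>\<^bsub>F\<^esub> a \<in> res ` (?W \<inter> \<O>)"
      unfolding a(3) k(3) res_mult[OF k(2) a(2), symmetric] using Wp(5)[OF k(1) a(1)] O_closed(4)[OF k(2) a(2)] by (intro imageI IntI)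
  qed
  then have "F.Span Kv (map res us) \<subseteq> res ` (?W \<inter> \<O>)"
  proof (rule F.subalgebra_Span_incl[OF Kv])
    show "set (map res us) \<subseteq> res ` (?W \<inter> \<O>)" using us by auto
  qed
  with sub have "F.Span Kv (map res us) = res ` (?W \<inter> \<O>)" by blast
  with us rusc that show thesis by blast
qed

end

subsection \<open>Polynomials in the generator\<close>

locale valued_simple_extension = valued_field_extension L v K
  for L :: "('a, 'b) ring_scheme" (structure) and v :: "'a \<Rightarrow> 'g::linordered_ab_group_add"
    and K :: "'a set" +
  fixes x :: 'a
  assumes x: "x \<in> carrier L" and gen: "generate_field L (insert x K) = carrier L"
begin

text \<open>Polynomials of degree below \<open>n\<close>, as elements of \<open>L\<close>. Degrees
  are only measured by this filtration: membership in \<open>pspan (Suc n)\<close> but not in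
  \<open>pspan n\<close> plays the role of degree \<open>n\<close>.\<close>

definition "pspan n = Span K (exp_base x n)"

lemma exp_base_carrier: "set (exp_base x n) \<subseteq> carrier L"
  using x by (auto simp: exp_base_def)

lemmas pspan_props = Span_subgroup_props[OF K exp_base_carrier, folded pspan_def]
  Span_smult_closed[OF K exp_base_carrier, folded pspan_def]

lemma pspan_carrier: "f \<in> pspan n \<Longrightarrow> f \<in> carrier L"
  using pspan_props(1) by blast

lemma pspan_0: "pspan 0 = {\<zero>}"
  by (simp add: pspan_def exp_base_def Span_Nil)

lemma pspan_Suc: "f \<in> pspan (Suc n) \<longleftrightarrow> (\<exists>k\<in>K. \<exists>p\<in>pspan n. f = k \<otimes> x [^] n \<oplus> p)"
proof -
  have "exp_base x (Suc n) = x [^] n # exp_base x n" by (simp add: exp_base_def)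
  then show ?thesis unfolding pspan_def by (simp only: Span_Cons line_extension_mem_iff)
qed

lemma pspan_Suc_mono: "pspan n \<subseteq> pspan (Suc n)"
proof
  fix f assume f: "f \<in> pspan n"
  then have "f = \<zero> \<otimes> x [^] n \<oplus> f" using x pspan_carrier by simp
  then show "f \<in> pspan (Suc n)" using pspan_Suc K_ring(2) f by blast
qed

lemma pspan_mono: "m \<le> n \<Longrightarrow> pspan m \<subseteq> pspan n"
  using lift_Suc_mono_le[of pspan] pspan_Suc_mono by blast

lemma pspan_1: "pspan 1 = K"
proof -
  have "K \<subseteq> carrier L" using K_ring(1) .
  then have "k \<otimes> \<one> \<oplus> \<zero> = k" if "k \<in> K" for k using that by auto
  then have "(\<exists>k\<in>K. f = k \<otimes> \<one> \<oplus> \<zero>) \<longleftrightarrow> f \<in> K" for f by (metis (no_types))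
  then show ?thesis using pspan_Suc[of _ 0] by (auto simp: pspan_0)
qed

lemma x_pow_pspan: "x [^] n \<in> pspan (Suc n)"
  unfolding pspan_Suc using x K_ring(3) pspan_props(2)[of n]
  by (intro bexI[of _ \<one>] bexI[of _ \<zero>]) auto

lemma pspan_mult_x: "f \<in> pspan n \<Longrightarrow> f \<otimes> x \<in> pspan (Suc n)"
proof (induct n arbitrary: f)
  case 0 then show ?case using x pspan_props(2) by (simp add: pspan_0)
next
  case (Suc n)
  then obtain k p where kp: "k \<in> K" "p \<in> pspan n" "f = k \<otimes> x [^] n \<oplus> p" unfolding pspan_Suc by blast
  have "k \<in> carrier L" "p \<in> carrier L" using kp K_ring(1) pspan_carrier by blast+
  then have "f \<otimes> x = k \<otimes> x [^] Suc n \<oplus> p \<otimes> x" unfolding kp(3) using x by (simp add: l_distr m_assoc)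
  then show ?case using Suc(1)[OF kp(2)] kp(1) pspan_Suc[of "f \<otimes> x" "Suc n"] by blast
qed

lemma pspan_mult_x_pow: "f \<in> pspan n \<Longrightarrow> f \<otimes> x [^] (m::nat) \<in> pspan (n + m)"
proof (induct m)
  case 0 then show ?case using pspan_carrier by simp
next
  case (Suc m)
  then have "(f \<otimes> x [^] m) \<otimes> x \<in> pspan (Suc (n + m))" using pspan_mult_x by blast
  then show ?case using Suc(2) x pspan_carrier[OF Suc(2)] by (simp add: m_assoc)
qed

text \<open>Indices count coefficients, so \<open>Suc n\<close> bounds the degree of
  \<open>g\<close> by \<open>n\<close>, and the bounds add up without loss.\<close>

lemma pspan_mult: "\<lbrakk>f \<in> pspan m; g \<in> pspan (Suc n)\<rbrakk> \<Longrightarrow> f \<otimes> g \<in> pspan (m + n)"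
proof (induct n arbitrary: g)
  case 0
  then have "g \<in> K" using pspan_1 by simp
  then have "g \<otimes> f \<in> pspan m" using 0 pspan_props(5) by blast
  then show ?case using \<open>g \<in> K\<close> K_ring(1) pspan_carrier[OF 0(1)] m_comm[of f g] by auto
next
  case (Suc n)
  then obtain k p where kp: "k \<in> K" "p \<in> pspan (Suc n)" "g = k \<otimes> x [^] Suc n \<oplus> p" using pspan_Suc by blast
  have c: "k \<in> carrier L" "p \<in> carrier L" "f \<in> carrier L"
    using kp K_ring(1) pspan_carrier Suc by blast+
  have "f \<otimes> g = k \<otimes> (f \<otimes> x [^] Suc n) \<oplus> f \<otimes> p" unfolding kp(3) using x c
    by (simp only: r_distr m_lcomm m_closed nat_pow_closed)
  moreover have "k \<otimes> (f \<otimes> x [^] Suc n) \<in> pspan (m + Suc n)"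
    using pspan_props(5)[OF kp(1) pspan_mult_x_pow[OF Suc(2)]] .
  moreover have "f \<otimes> p \<in> pspan (m + Suc n)" using Suc(1)[OF Suc(2) kp(2)] pspan_Suc_mono by auto
  ultimately show ?case using pspan_props(3) by simp
qed

text \<open>Long division, removing one leading term per induction step. Excluding
  \<open>pspan d\<close> makes the leading coefficient of \<open>Q\<close> nonzero, hence invertible
  in \<open>K\<close>.\<close>

lemma pspan_division:
  assumes Q: "Q \<in> pspan (Suc d) - pspan d"
  shows "f \<in> pspan (m + d) \<Longrightarrow> \<exists>a\<in>pspan m. \<exists>b\<in>pspan d. f = a \<otimes> Q \<oplus> b"
proof (induct m arbitrary: f)
  case 0
  then have "f = \<zero> \<otimes> Q \<oplus> f" using Q pspan_carrier by auto
  then show ?case using 0 pspan_props(2) by fastforce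
next
  case (Suc m)
  obtain c q where cq: "c \<in> K" "q \<in> pspan d" "Q = c \<otimes> x [^] d \<oplus> q" using Q pspan_Suc by blast
  obtain k p where kp: "k \<in> K" "p \<in> pspan (m + d)" "f = k \<otimes> x [^] (m + d) \<oplus> p"
    using Suc(2) pspan_Suc by auto
  have "c \<noteq> \<zero>"
  proof
    assume "c = \<zero>" then have "Q = q" using cq x pspan_carrier by simp
    then show False using Q cq by blast
  qed
  then have c: "c \<in> Knz" using cq by blast
  have cn: "c \<in> nz" and icn: "inv c \<in> Knz" using c Knz_nz Knz_inv by blast+
  have car: "c \<in> carrier L" "inv c \<in> carrier L" "k \<in> carrier L" "q \<in> carrier L" "p \<in> carrier L"
    "x [^] m \<in> carrier L" "x [^] d \<in> carrier L"
    using cn icn Knz_nz kp K_ring(1) cq pspan_carrier x by blast+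
  \<comment> \<open>The leading term of the quotient: \<open>a Q\<close> and \<open>f\<close> agree
    in their top term, so the difference drops into \<open>pspan (m + d)\<close>.\<close>
  define a where "a = (k \<otimes> inv c) \<otimes> x [^] m"
  have kcK: "k \<otimes> inv c \<in> K" using K_ring(6) kp icn by blast
  have aS: "a \<in> pspan (Suc m)" unfolding a_def
    using pspan_props(5)[OF kcK x_pow_pspan] .
  have ac: "a \<in> carrier L" using aS pspan_carrier by blast
  have Qc: "Q \<in> carrier L" using Q pspan_carrier by blast
  have "(k \<otimes> inv c) \<otimes> (q \<otimes> x [^] m) \<in> pspan (d + m)" using pspan_props(5)[OF kcK pspan_mult_x_pow[OF cq(2)]] .
  then have aq: "a \<otimes> q \<in> pspan (m + d)" using car by (simp add: a_def m_ac add.commute)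
  have "a \<otimes> (c \<otimes> x [^] d) = (k \<otimes> (inv c \<otimes> c)) \<otimes> (x [^] m \<otimes> x [^] d)"
    using car by (simp only: a_def m_ac m_closed)
  also have "\<dots> = k \<otimes> x [^] (m + d)" using cn car x by (simp add: nat_pow_mult)
  finally have aQ: "a \<otimes> Q = k \<otimes> x [^] (m + d) \<oplus> a \<otimes> q" unfolding cq(3) using car ac by (simp add: r_distr)
  have kx: "k \<otimes> x [^] (m + d) \<in> carrier L" using car x by simp
  have "p \<oplus> \<ominus> (a \<otimes> q) \<in> pspan (m + d)" using pspan_props(3)[OF kp(2) pspan_props(4)[OF aq]] .
  then obtain a' b where ab: "a' \<in> pspan m" "b \<in> pspan d" "p \<oplus> \<ominus> (a \<otimes> q) = a' \<otimes> Q \<oplus> b"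
    using Suc(1) by blast
  have ab_c: "a' \<in> carrier L" "b \<in> carrier L" using ab pspan_carrier by blast+
  have "f = a \<otimes> Q \<oplus> (p \<oplus> \<ominus> (a \<otimes> q))" unfolding kp(3) aQ using kx car ac by algebra
  also have "\<dots> = (a \<oplus> a') \<otimes> Q \<oplus> b" unfolding ab(3) using ac ab_c Qc by algebra
  finally show ?case using ab pspan_props(3)[OF aS] pspan_Suc_mono[of m] by blast
qed

text \<open>Fractions of polynomials are closed under all rules that generate \<open>K(x)\<close>.
  Numerator and denominator share one index \<open>n\<close>, so that a single finite set of value
  representatives covers both.\<close>

lemma fraction_pspan:
  assumes "r \<in> carrier L" obtains n f g where "f \<in> pspan n" "g \<in> pspan n - {\<zero>}" "r = f \<otimes> inv g"
proof -
  let ?P = "\<Union>n. pspan n"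
  let ?T = "{f \<otimes> inv g | f g. f \<in> ?P \<and> g \<in> ?P - {\<zero>}}"
  have Pc: "f \<in> carrier L" if "f \<in> ?P" for f using that pspan_carrier by blast
  have Pm: "f \<otimes> g \<in> ?P" if fgP: "f \<in> ?P" "g \<in> ?P" for f g
  proof -
    obtain m n where mn: "f \<in> pspan m" "g \<in> pspan n" using fgP by blast
    then have "g \<in> pspan (Suc n)" using pspan_Suc_mono by blast
    then show ?thesis using pspan_mult[OF mn(1)] by blast
  qed
  have Pa: "f \<oplus> g \<in> ?P" if fgP: "f \<in> ?P" "g \<in> ?P" for f g
  proof -
    obtain m n where "f \<in> pspan m" "g \<in> pspan n" using fgP by blast
    then have "f \<in> pspan (max m n)" "g \<in> pspan (max m n)" using pspan_mono[of m "max m n"] pspan_mono[of n "max m n"] by auto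
    then show ?thesis using pspan_props(3) by blast
  qed
  have KP: "K \<subseteq> ?P" using pspan_1 by blast
  have P1: "\<one> \<in> ?P" using KP K_ring(3) by blast
  have TI: "f \<otimes> inv g \<in> ?T" if "f \<in> ?P" "g \<in> ?P - {\<zero>}" for f g using that by blast
  have PT: "f \<in> ?T" if "f \<in> ?P" for f
  proof -
    have "f = f \<otimes> inv \<one>" using Pc that by simp
    then show ?thesis using that P1 by force
  qed
  have Pmn: "f \<otimes> g \<in> ?P - {\<zero>}" if "f \<in> ?P - {\<zero>}" "g \<in> ?P - {\<zero>}" for f g
    using that Pm[of f g] nz_mult[of f g] Pc by blast
  have "r \<in> ?T" if "r \<in> generate_field L (insert x K)" for r
    using that
  proof induct
    case one then show ?case using PT P1 by blast
  next
    case (incl h)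
    have "x \<in> ?P" using x_pow_pspan[of 1] x by auto
    then show ?case using PT incl KP by blast
  next
    case (a_inv h)
    then obtain f g where fg: "f \<in> ?P" "g \<in> ?P - {\<zero>}" "h = f \<otimes> inv g" by blast
    have "inv g \<in> carrier L" using nz_inv[of g] Pc fg by blast
    then have "\<ominus> h = (\<ominus> f) \<otimes> inv g" using Pc fg by (simp add: l_minus)
    moreover have "\<ominus> f \<in> ?P" using fg pspan_props(4) by blast
    ultimately show ?case using fg by blast
  next
    case (m_inv h)
    then obtain f g where fg: "f \<in> ?P" "g \<in> ?P - {\<zero>}" "h = f \<otimes> inv g" by blast
    have g: "g \<in> nz" "inv g \<in> nz" using nz_inv[of g] Pc fg by blast+
    have "f \<noteq> \<zero>" using m_inv(3) fg g by auto
    then have f: "f \<in> ?P - {\<zero>}" using fg(1) by (rule_tac DiffI) simp_all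
    have "inv h = g \<otimes> inv f" unfolding fg(3)
      using inv_mult_nz[of f "inv g"] g inv_inv_nz[OF g(1)] Pc[of f] fg(1) \<open>f \<noteq> \<zero>\<close> nz_inv[of f] m_comm by auto
    moreover have "g \<in> ?P" using fg(2) by (rule DiffD1)
    ultimately have "\<exists>f g. inv h = f \<otimes> inv g \<and> f \<in> ?P \<and> g \<in> ?P - {\<zero>}"
      using f by (intro exI[of _ g] exI[of _ f] conjI)
    then show ?case by simp
  next
    case (eng_add h1 h2)
    then obtain f g f' g' where fg: "f \<in> ?P" "g \<in> ?P - {\<zero>}" "h1 = f \<otimes> inv g"
       "f' \<in> ?P" "g' \<in> ?P - {\<zero>}" "h2 = f' \<otimes> inv g'" by blast
    have g: "g \<in> nz" "inv g \<in> nz" "g' \<in> nz" "inv g' \<in> nz" using nz_inv[of g] nz_inv[of g'] Pc fg by blast+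
    have c: "f \<in> carrier L" "f' \<in> carrier L" "g \<in> carrier L" "g' \<in> carrier L" "inv g \<in> carrier L" "inv g' \<in> carrier L"
      using Pc fg g by blast+
    have "(f \<otimes> g' \<oplus> f' \<otimes> g) \<otimes> (inv g \<otimes> inv g') = (f \<otimes> inv g) \<otimes> (g' \<otimes> inv g') \<oplus> (f' \<otimes> inv g') \<otimes> (g \<otimes> inv g)"
      using c by algebra
    then have "h1 \<oplus> h2 = (f \<otimes> g' \<oplus> f' \<otimes> g) \<otimes> inv (g \<otimes> g')"
      unfolding fg(3,6) inv_mult_nz[OF g(1,3)] using g c by simp
    moreover have "f \<otimes> g' \<oplus> f' \<otimes> g \<in> ?P"
      using Pa[OF Pm[OF fg(1) DiffD1[OF fg(5)]] Pm[OF fg(4) DiffD1[OF fg(2)]]] .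
    ultimately show ?case using TI[OF _ Pmn[OF fg(2,5)]] by simp
  next
    case (eng_mult h1 h2)
    then obtain f g f' g' where fg: "f \<in> ?P" "g \<in> ?P - {\<zero>}" "h1 = f \<otimes> inv g"
       "f' \<in> ?P" "g' \<in> ?P - {\<zero>}" "h2 = f' \<otimes> inv g'" by blast
    have g: "g \<in> nz" "inv g \<in> nz" "g' \<in> nz" "inv g' \<in> nz" using nz_inv[of g] nz_inv[of g'] Pc fg by blast+
    have c: "f \<in> carrier L" "f' \<in> carrier L" "g \<in> carrier L" "g' \<in> carrier L" "inv g \<in> carrier L" "inv g' \<in> carrier L"
      using Pc fg g by blast+
    have "h1 \<otimes> h2 = (f \<otimes> f') \<otimes> inv (g \<otimes> g')"
      unfolding fg(3,6) inv_mult_nz[OF g(1,3)] using c by algebra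
    moreover have "f \<otimes> f' \<in> ?P" using Pm[OF fg(1,4)] .
    ultimately show ?case using TI[OF _ Pmn[OF fg(2,5)]] by simp
  qed
  then have "r \<in> ?T" using assms gen by blast
  then obtain f g where fgP: "f \<in> ?P" "g \<in> ?P - {\<zero>}" "r = f \<otimes> inv g" by blast
  then obtain m n where fg: "f \<in> pspan m" "g \<in> pspan n - {\<zero>}" by blast
  have "f \<in> pspan (max m n)" "g \<in> pspan (max m n) - {\<zero>}"
    using fg pspan_mono[of m "max m n"] pspan_mono[of n "max m n"] by auto
  with fgP(3) that show thesis by blast
qed

end

subsection \<open>Quotients of ordered groups\<close>

lemma add_grp_simps [simp]:
  "carrier (add_grp A) = A" "x \<otimes>\<^bsub>add_grp A\<^esub> y = x + y" "\<one>\<^bsub>add_grp A\<^esub> = 0"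
  by (simp_all add: add_grp_def)

lemma group_add_grp: "comm_group (add_grp (UNIV :: 'g::ab_group_add set))"
  by (rule comm_groupI) (auto simp: ac_simps intro: exI[of _ "- _"] left_minus)

lemma subgroup_add_grpI:
  fixes A :: "'g::ab_group_add set"
  assumes "0 \<in> A" "\<And>a b. \<lbrakk>a \<in> A; b \<in> A\<rbrakk> \<Longrightarrow> a + b \<in> A" "\<And>a. a \<in> A \<Longrightarrow> - a \<in> A"
  shows "subgroup A (add_grp UNIV)"
proof -
  interpret G: comm_group "add_grp (UNIV :: 'g set)" by (rule group_add_grp)
  show ?thesis
  proof (rule G.subgroupI)
    fix a assume "a \<in> A"
    moreover have "inv\<^bsub>add_grp UNIV\<^esub> a = - a" by (rule G.inv_equality) auto
    ultimately show "inv\<^bsub>add_grp UNIV\<^esub> a \<in> A" using assms(3) by simp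
  qed (use assms in auto)
qed

locale group_pair =
  fixes A C :: "'g::ab_group_add set"
  assumes A: "subgroup A (add_grp UNIV)" and C: "subgroup C (add_grp UNIV)" and AC: "A \<subseteq> C"
begin

lemma add_grp_C: "comm_group (add_grp C)"
proof -
  interpret G: comm_group "add_grp (UNIV :: 'g set)" by (rule group_add_grp)
  have "(add_grp UNIV)\<lparr>carrier := C\<rparr> = add_grp C" by (simp add: add_grp_def)
  then have "group (add_grp C)" using G.subgroup_imp_group[OF C] by simp
  then show ?thesis by (rule group.group_comm_groupI) (simp add: add.commute)
qed

lemma normal_A: "A \<lhd> add_grp C"
proof -
  interpret G: comm_group "add_grp (UNIV :: 'g set)" by (rule group_add_grp)
  interpret C: comm_group "add_grp C" by (rule add_grp_C)
  have "(add_grp UNIV)\<lparr>carrier := C\<rparr> = add_grp C" by (simp add: add_grp_def)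
  then have "subgroup A (add_grp C)" using G.subgroup_incl[OF A C AC] by simp
  then show ?thesis by (rule C.subgroup_imp_normal)
qed

lemma coset_eq: "A #>\<^bsub>add_grp C\<^esub> c = (\<lambda>a. a + c) ` A"
  by (auto simp: r_coset_def)

lemma carrier_quotient: "carrier (add_grp C Mod A) = (\<lambda>c. (\<lambda>a. a + c) ` A) ` C"
  by (simp add: carrier_FactGroup coset_eq)

lemma coset_add: assumes "a \<in> A" shows "(\<lambda>b. b + (s + a)) ` A = (\<lambda>b. b + s) ` A"
proof -
  interpret G: comm_group "add_grp (UNIV :: 'g set)" by (rule group_add_grp)
  have "- a \<in> A"
  proof -
    have "inv\<^bsub>add_grp UNIV\<^esub> a = - a" by (rule G.inv_equality) auto
    then show ?thesis using subgroup.m_inv_closed[OF A assms] by simp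
  qed
  moreover have "x + y \<in> A" if "x \<in> A" "y \<in> A" for x y using subgroup.m_closed[OF A that] by simp
  ultimately have *: "b + a \<in> A" "b + - a \<in> A" if "b \<in> A" for b using that assms by blast+
  have e: "b + (s + a) = (b + a) + s" "b + s = (b + - a) + (s + a)" for b by (simp_all add: algebra_simps)
  show ?thesis
  proof
    show "(\<lambda>b. b + (s + a)) ` A \<subseteq> (\<lambda>b. b + s) ` A" using *(1) e(1) by (intro image_subsetI) (metis imageI)
    show "(\<lambda>b. b + s) ` A \<subseteq> (\<lambda>b. b + (s + a)) ` A" using *(2) e(2) by (intro image_subsetI) (metis imageI)
  qed
qed

text \<open>Bounds a quotient by a set of representatives; \<open>S\<close> is finite in some
  applications and countable in another.\<close>

lemma carrier_quotient_subset:
  assumes "\<And>c. c \<in> C \<Longrightarrow> \<exists>s\<in>S. \<exists>a\<in>A. c = s + a"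
  shows "carrier (add_grp C Mod A) \<subseteq> (\<lambda>s. (\<lambda>a. a + s) ` A) ` S"
  unfolding carrier_quotient
proof (rule image_subsetI)
  fix c assume "c \<in> C"
  then obtain s a where "s \<in> S" "a \<in> A" "c = s + a" using assms by blast
  then show "(\<lambda>a. a + c) ` A \<in> (\<lambda>s. (\<lambda>a. a + s) ` A) ` S" using coset_add[of a s] by simp
qed

text \<open>A power is an iterated operation and does not see the carrier, so the natural multiples
  \<open>n a\<close> can be formed in the ambient group throughout.\<close>

lemma pow_add_grp: "a [^]\<^bsub>add_grp C\<^esub> (n::nat) = a [^]\<^bsub>add_grp (UNIV::'g set)\<^esub> n"
  by (simp add: nat_pow_def add_grp_def)

text \<open>A power of a coset is the coset of the power. Torsion thus becomes a statement about
  elements, which is the form in which values are available.\<close>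

lemma torsion_quotient_iff:
  "torsion_group (add_grp C Mod A) \<longleftrightarrow> (\<forall>c\<in>C. \<exists>n::nat>0. c [^]\<^bsub>add_grp (UNIV::'g set)\<^esub> n \<in> A)"
proof -
  interpret C: comm_group "add_grp C" by (rule add_grp_C)
  interpret A: normal A "add_grp C" by (rule normal_A)
  have cl: "c [^]\<^bsub>add_grp C\<^esub> n \<in> C" if "c \<in> C" for c and n :: nat
    using C.nat_pow_closed[of c n] that by simp
  have "(A #>\<^bsub>add_grp C\<^esub> c) [^]\<^bsub>add_grp C Mod A\<^esub> n = \<one>\<^bsub>add_grp C Mod A\<^esub> \<longleftrightarrow> c [^]\<^bsub>add_grp (UNIV::'g set)\<^esub> n \<in> A"
    if "c \<in> C" for c and n :: nat
  proof -
    have "(A #>\<^bsub>add_grp C\<^esub> c) [^]\<^bsub>add_grp C Mod A\<^esub> n = A #>\<^bsub>add_grp C\<^esub> (c [^]\<^bsub>add_grp C\<^esub> n)"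
      using A.FactGroup_pow[of c n] that by simp
    moreover have "A #>\<^bsub>add_grp C\<^esub> y = A \<longleftrightarrow> y \<in> A" if "y \<in> C" for y
      using C.coset_join1[OF _ _ A.is_subgroup, of y] C.coset_join2[OF _ A.is_subgroup, of y] that by auto
    ultimately show ?thesis using cl[OF that, of n] by (simp add: pow_add_grp)
  qed
  moreover have "carrier (add_grp C Mod A) = (\<lambda>c. A #>\<^bsub>add_grp C\<^esub> c) ` C"
    by (simp add: carrier_FactGroup)
  ultimately show ?thesis unfolding torsion_group_def by auto
qed

lemma torsion_quotient_if_finite:
  assumes "finite (carrier (add_grp C Mod A))" shows "torsion_group (add_grp C Mod A)"
proof -
  interpret Q: group "add_grp C Mod A" by (rule normal.factorgroup_is_group[OF normal_A])
  show ?thesis unfolding torsion_group_def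
    using Q.pow_order_eq_1 assms Q.order_gt_0_iff_finite by blast
qed

end

subsection \<open>Countability\<close>

text \<open>Multiplication by \<open>a\<close> is \<open>K\<close>-linear. It allows
  \<open>pspan n\<close> to be rescaled before residues are taken.\<close>

lemma (in ring) Span_mult_r:
  assumes "K \<subseteq> carrier R" "a \<in> carrier R" "set us \<subseteq> carrier R" "f \<in> Span K us"
  shows "f \<otimes> a \<in> Span K (map (\<lambda>u. u \<otimes> a) us)"
  using assms(3,4)
proof (induct us arbitrary: f)
  case Nil then show ?case using assms(2) by (simp add: Span_Nil)
next
  case (Cons u us)
  obtain k z where kz: "k \<in> K" "z \<in> Span K us" "f = k \<otimes> u \<oplus> z"
    using Cons(3) line_extension_mem_iff[of f K u "Span K us"] unfolding Span_Cons by blast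
  have "k \<in> carrier R" "u \<in> carrier R" "z \<in> carrier R"
    using kz(1,2) assms(1) Cons(2) Span_in_carrier[of K us] by auto
  then have "f \<otimes> a = k \<otimes> (u \<otimes> a) \<oplus> z \<otimes> a" unfolding kz(3) using assms(2) by (simp add: l_distr m_assoc)
  then show ?case using Cons(1)[OF _ kz(2)] Cons(2) kz(1)
    line_extension_mem_iff[of "f \<otimes> a" K "u \<otimes> a" "Span K (map (\<lambda>u. u \<otimes> a) us)"]
    unfolding list.map Span_Cons by auto
qed

section \<open>The value groups of \<open>L\<close> and \<open>K\<close>\<close>

context valued_field_extension
begin

abbreviation "vL \<equiv> value_set L v (carrier L)"
abbreviation "vK \<equiv> value_set L v K"

lemma subgroup_val_image:
  assumes "H \<subseteq> nz" "\<one> \<in> H" "\<And>a b. \<lbrakk>a \<in> H; b \<in> H\<rbrakk> \<Longrightarrow> a \<otimes> b \<in> H" "\<And>a. a \<in> H \<Longrightarrow> inv a \<in> H"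
  shows "subgroup (v ` H) (add_grp UNIV)"
proof (rule subgroup_add_grpI)
  show "0 \<in> v ` H" using assms(2) val_one by (metis imageI)
next
  fix a b assume "a \<in> v ` H" "b \<in> v ` H"
  then obtain a' b' where ab: "a' \<in> H" "b' \<in> H" "a = v a'" "b = v b'" by blast
  then have "a + b = v (a' \<otimes> b')" using val_mult[of a' b'] subsetD[OF assms(1)] by simp
  then show "a + b \<in> v ` H" using assms(3)[OF ab(1,2)] by blast
next
  fix a assume "a \<in> v ` H"
  then obtain a' where a: "a' \<in> H" "a = v a'" by blast
  then have "- a = v (inv a')" using val_inv[of a'] subsetD[OF assms(1)] by simp
  then show "- a \<in> v ` H" using assms(4)[OF a(1)] by blast
qed

lemma subgroup_vL: "subgroup vL (add_grp UNIV)"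
  unfolding value_set_def using nz_mult nz_inv by (intro subgroup_val_image) auto

lemma subgroup_vK: "subgroup vK (add_grp UNIV)"
  unfolding value_set_def
  by (rule subgroup_val_image) (use Knz_nz Knz_mult Knz_inv K_ring(3) in auto)

lemma vK_subset_vL: "vK \<subseteq> vL"
  unfolding value_set_def using K_ring(1) by blast

end

sublocale valued_field_extension \<subseteq> value_groups: group_pair vK vL
  by (rule group_pair.intro[OF subgroup_vK subgroup_vL vK_subset_vL])

context valued_field_extension
begin

lemma val_pow_add_grp: assumes "r \<in> nz" shows "v (r [^] (n::nat)) = v r [^]\<^bsub>add_grp UNIV\<^esub> n"
proof -
  interpret G: comm_group "add_grp (UNIV :: 'g set)" by (rule group_add_grp)
  show ?thesis by (induct n) (use assms val_pow[OF assms] in auto)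
qed

end

section \<open>Countability of the value quotient and of residue generators\<close>

context valued_simple_extension
begin

lemma pspan_values_finite:
  obtains S where "finite S" "S \<subseteq> pspan n - {\<zero>}"
    "\<And>f. f \<in> pspan n - {\<zero>} \<Longrightarrow> \<exists>s\<in>S. \<exists>c\<in>Knz. v f = v s + v c"
  using Span_values_finite[OF exp_base_carrier, of n] unfolding pspan_def[symmetric] by blast

lemma fraction_pspan_nz:
  assumes "r \<in> nz" obtains n f g where "f \<in> pspan n - {\<zero>}" "g \<in> pspan n - {\<zero>}" "r = f \<otimes> inv g"
proof -
  obtain n f g where fg: "f \<in> pspan n" "g \<in> pspan n - {\<zero>}" "r = f \<otimes> inv g"
    using fraction_pspan assms by blast
  have "g \<in> nz" using fg(2) pspan_carrier by blast
  then have "f \<noteq> \<zero>" using fg assms nz_inv[of g] by auto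
  with fg that show thesis by blast
qed

lemma pspan_nz: "f \<in> pspan n - {\<zero>} \<Longrightarrow> f \<in> nz"
  using pspan_carrier by blast

text \<open>\<open>L\<close> consists of fractions from the countably many spaces
  \<open>pspan n\<close>, each with finitely many values modulo \<open>vK\<close>. Differences of
  representatives therefore represent all values.\<close>

lemma countable_value_quotient: "countable (carrier (add_grp vL Mod vK))"
proof -
  have "\<exists>S. finite S \<and> S \<subseteq> pspan n - {\<zero>} \<and> (\<forall>f \<in> pspan n - {\<zero>}. \<exists>s\<in>S. \<exists>c\<in>Knz. v f = v s + v c)" for n
    using pspan_values_finite[of n] by metis
  then obtain S where S: "\<And>n. finite (S n)" "\<And>n. S n \<subseteq> pspan n - {\<zero>}"
     "\<And>n f. f \<in> pspan n - {\<zero>} \<Longrightarrow> \<exists>s\<in>S n. \<exists>c\<in>Knz. v f = v s + v c" by metis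
  define D where "D = (\<lambda>(s, s'). v s - v s') ` ((\<Union>n. S n) \<times> (\<Union>n. S n))"
  have "countable (\<Union>n. S n)" using S(1) by (intro countable_UN) (auto intro: countable_finite)
  then have "countable D" unfolding D_def by (intro countable_image countable_SIGMA)
  have "\<exists>s\<in>D. \<exists>a\<in>vK. c = s + a" if cL: "c \<in> vL" for c
  proof -
    obtain r where r: "r \<in> nz" "c = v r" using cL unfolding value_set_def by blast
    obtain n f g where fg: "f \<in> pspan n - {\<zero>}" "g \<in> pspan n - {\<zero>}" "r = f \<otimes> inv g"
      by (rule fraction_pspan_nz[OF r(1)])
    obtain s k where s: "s \<in> S n" "k \<in> Knz" "v f = v s + v k" using S(3)[OF fg(1)] by blast
    obtain s' k' where s': "s' \<in> S n" "k' \<in> Knz" "v g = v s' + v k'" using S(3)[OF fg(2)] by blast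
    have "v r = v f - v g"
      using val_mult[OF pspan_nz[OF fg(1)] nz_inv[OF pspan_nz[OF fg(2)]]] val_inv[OF pspan_nz[OF fg(2)]] fg(3) by simp
    also have "\<dots> = (v s - v s') + (v k - v k')" by (simp add: s(3) s'(3))
    also have "v k - v k' = v (k \<otimes> inv k')"
      using val_mult[OF Knz_nz[OF s(2)] Knz_nz[OF Knz_inv[OF s'(2)]]] val_inv[OF Knz_nz[OF s'(2)]] by simp
    finally have "c = (v s - v s') + v (k \<otimes> inv k')" using r by simp
    moreover have "v s - v s' \<in> D" unfolding D_def using s(1) s'(1) by force
    moreover have "v (k \<otimes> inv k') \<in> vK" unfolding value_set_def using Knz_mult[OF s(2) Knz_inv[OF s'(2)]] by (rule imageI)
    ultimately show ?thesis by (intro bexI)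
  qed
  then have "carrier (add_grp vL Mod vK) \<subseteq> (\<lambda>s. (\<lambda>a. a + s) ` vK) ` D"
    by (rule value_groups.carrier_quotient_subset)
  then show ?thesis by (rule countable_subset[OF _ countable_image[OF \<open>countable D\<close>]])
qed

text \<open>A unit \<open>f / g\<close> has \<open>v f = v g\<close>, so one factor
  \<open>1 / (s c)\<close>, with \<open>s\<close> from a finite set and \<open>c\<close> in
  \<open>K\<close>, makes both \<open>f\<close> and \<open>g\<close> units. Their residues lie in
  the residue space of \<open>pspan n\<close> scaled by \<open>1 / s\<close>, which has a finite
  basis. The union of these bases over all \<open>n\<close> and \<open>s\<close> generates.\<close>

lemma countably_generated_residue_field: "countably_generated_field_extension F Kv"
proof -
  have "\<exists>S. finite S \<and> S \<subseteq> pspan n - {\<zero>} \<and> (\<forall>f \<in> pspan n - {\<zero>}. \<exists>s\<in>S. \<exists>c\<in>Knz. v f = v s + v c)" for n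
    using pspan_values_finite[of n] by metis
  then obtain S where S: "\<And>n. finite (S n)" "\<And>n. S n \<subseteq> pspan n - {\<zero>}"
     "\<And>n f. f \<in> pspan n - {\<zero>} \<Longrightarrow> \<exists>s\<in>S n. \<exists>c\<in>Knz. v f = v s + v c" by metis
  have scaled: "set (map (\<lambda>u. u \<otimes> inv s) (exp_base x n)) \<subseteq> carrier L" if "s \<in> nz" for s n
    using exp_base_carrier[of n] nz_inv[OF that] by auto
  define Q where "Q s n B \<longleftrightarrow> set B \<subseteq> carrier F \<and>
      F.Span Kv B = res ` (Span K (map (\<lambda>u. u \<otimes> inv s) (exp_base x n)) \<inter> \<O>)" for s n B
  have "\<exists>B. Q s n B" if "s \<in> nz" for s n
    unfolding Q_def by (rule Span_residues_finite_dimension[OF scaled[OF that, of n]]) blast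
  then obtain B where "\<And>s n. s \<in> nz \<Longrightarrow> Q s n (B s n)" by metis
  then have B: "\<And>s n. s \<in> nz \<Longrightarrow> set (B s n) \<subseteq> carrier F"
      "\<And>s n. s \<in> nz \<Longrightarrow> F.Span Kv (B s n) = res ` (Span K (map (\<lambda>u. u \<otimes> inv s) (exp_base x n)) \<inter> \<O>)"
    unfolding Q_def by simp_all
  define D where "D = (\<Union>n. \<Union>s\<in>S n. set (B s n))"
  have Snz: "s \<in> nz" if "s \<in> S n" for s n using that S(2) pspan_nz by blast
  have DF: "D \<subseteq> carrier F" unfolding D_def by (intro UN_least B(1)[OF Snz])
  have cD: "countable D" unfolding D_def using S(1) by (intro countable_UN) (auto intro: countable_finite)
  let ?T = "generate_field F (Kv \<union> D)"
  have gc: "Kv \<union> D \<subseteq> carrier F" using DF subfieldE(3)[OF Kv] by blast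
  have T: "subfield ?T F" by (rule F.generate_field_is_subfield[OF gc])
  note Tr = subringE[OF subfieldE(1)[OF T]]
  have inc: "Kv \<union> D \<subseteq> ?T" by (intro subsetI generate_field.incl)
  have Talg: "subalgebra Kv ?T F"
    by (intro subalgebra.intro F.generate_field_is_add_subgroup[OF gc] subalgebra_axioms.intro)
      (use Tr(6) inc in blast)
  have unit: "res r \<in> ?T" if "r \<in> val_units" for r
  proof -
    have rn: "r \<in> nz" "v r = 0" using that by (auto simp: val_units_def)
    obtain n f g where fg: "f \<in> pspan n - {\<zero>}" "g \<in> pspan n - {\<zero>}" "r = f \<otimes> inv g"
      by (rule fraction_pspan_nz[OF rn(1)])
    note fn = pspan_nz[OF fg(1)] and gn = pspan_nz[OF fg(2)]
    obtain s c where s: "s \<in> S n" "c \<in> Knz" "v f = v s + v c" using S(3)[OF fg(1)] by blast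
    note sn = Snz[OF s(1)] and cn = Knz_nz[OF s(2)]
    have vg: "v g = v s + v c"
      using val_mult[OF fn nz_inv[OF gn]] val_inv[OF gn] fg(3) rn s(3) by simp
    define a where "a = inv s \<otimes> inv c"
    have an: "a \<in> nz" unfolding a_def using nz_mult nz_inv sn cn by blast
    have va: "v a = - (v s + v c)" unfolding a_def
      using val_mult[OF nz_inv[OF sn] nz_inv[OF cn]] val_inv[OF sn] val_inv[OF cn] by simp
    have key: "p \<otimes> a \<in> val_units \<and> res (p \<otimes> a) \<in> ?T" if p: "p \<in> pspan n - {\<zero>}" "v p = v s + v c" for p
    proof -
      note pn = pspan_nz[OF p(1)]
      have u: "p \<otimes> a \<in> val_units" unfolding val_units_def using nz_mult[OF pn an] val_mult[OF pn an] va p(2) by simp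
      have "inv c \<otimes> p \<in> pspan n" using pspan_props(5) Knz_inv[OF s(2)] p by blast
      then have "(inv c \<otimes> p) \<otimes> inv s \<in> Span K (map (\<lambda>u. u \<otimes> inv s) (exp_base x n))"
        using Span_mult_r[OF K_ring(1) _ exp_base_carrier] nz_inv[OF sn] unfolding pspan_def by blast
      moreover have "(inv c \<otimes> p) \<otimes> inv s = p \<otimes> a" unfolding a_def
        using nz_inv[OF sn] nz_inv[OF cn] pn by (simp add: m_ac)
      ultimately have "p \<otimes> a \<in> Span K (map (\<lambda>u. u \<otimes> inv s) (exp_base x n)) \<inter> \<O>"
        using val_units_O[OF u] by simp
      then have "res (p \<otimes> a) \<in> F.Span Kv (B s n)" unfolding B(2)[OF sn] by (rule imageI)
      moreover have "F.Span Kv (B s n) \<subseteq> ?T"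
      proof (rule F.subalgebra_Span_incl[OF Kv Talg])
        have "set (B s n) \<subseteq> D" unfolding D_def using s(1) by blast
        then show "set (B s n) \<subseteq> ?T" using inc by blast
      qed
      ultimately show ?thesis using u by blast
    qed
    have f: "f \<otimes> a \<in> val_units" "res (f \<otimes> a) \<in> ?T" using key[OF fg(1) s(3)] by blast+
    have g: "g \<otimes> a \<in> val_units" "res (g \<otimes> a) \<in> ?T" using key[OF fg(2) vg] by blast+
    have "(f \<otimes> a) \<otimes> inv (g \<otimes> a) = (f \<otimes> inv g) \<otimes> (a \<otimes> inv a)"
    proof -
      have "f \<in> carrier L" "inv g \<in> carrier L" "a \<in> carrier L" "inv a \<in> carrier L"
        using fn nz_inv[OF gn] an nz_inv[OF an] by blast+
      then show ?thesis unfolding inv_mult_nz[OF gn an] by algebra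
    qed
    then have "r = (f \<otimes> a) \<otimes> inv (g \<otimes> a)" using fg(3) an rn by simp
    then have "res r = res (f \<otimes> a) \<otimes>\<^bsub>F\<^esub> inv\<^bsub>F\<^esub> res (g \<otimes> a)"
      using res_mult[OF val_units_O[OF f(1)] val_units_O[OF val_units_inv[OF g(1)]]] res_inv[OF g(1)] by simp
    moreover have "inv\<^bsub>F\<^esub> res (g \<otimes> a) \<in> ?T"
      using F.subfield_m_inv(1)[OF T, of "res (g \<otimes> a)"] g res_nz[OF g(1)] by blast
    ultimately show ?thesis using Tr(6)[OF f(2)] by simp
  qed
  have "carrier F \<subseteq> ?T"
  proof
    fix y assume "y \<in> carrier F"
    then obtain r where r: "r \<in> \<O>" "y = res r" unfolding carrier_F by blast
    show "y \<in> ?T"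
    proof (cases "r \<in> val_units")
      case False
      then have "y = \<zero>\<^bsub>F\<^esub>" using val_units_iff[OF r(1)] r(2) by simp
      then show ?thesis using Tr(2) by simp
    qed (use unit r in simp)
  qed
  then have "?T = carrier F" using Tr(1) by blast
  then show ?thesis unfolding countably_generated_field_extension_def using DF cD by blast
qed

end

subsection \<open>Key polynomials\<close>

text \<open>The degree of \<open>Q\<close> is exactly \<open>d\<close>: \<open>Q_pspan\<close>
  bounds it, and membership in \<open>pspan d\<close> would give algebraic type by
  \<open>pspan_type\<close>.\<close>

locale key_polynomial = valued_simple_extension L v K x
  for L :: "('a, 'b) ring_scheme" (structure) and v :: "'a \<Rightarrow> 'g::linordered_ab_group_add"
    and K :: "'a set" and x :: 'a +
  fixes d :: nat and Q :: 'a
  assumes Q_pspan: "Q \<in> pspan (Suc d)" and Q_nonzero: "Q \<noteq> \<zero>" and Q_type: "Q \<notin> alg_type"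
    and pspan_type: "pspan d - {\<zero>} \<subseteq> alg_type"

lemma (in valued_simple_extension) key_polynomial_exists:
  assumes "\<not> (\<forall>n. pspan n - {\<zero>} \<subseteq> alg_type)"
  obtains d Q where "key_polynomial L v K x d Q"
proof -
  define n where "n = (LEAST n. \<not> pspan n - {\<zero>} \<subseteq> alg_type)"
  have n: "\<not> pspan n - {\<zero>} \<subseteq> alg_type" unfolding n_def by (rule LeastI_ex) (use assms in blast)
  then have "n \<noteq> 0" using pspan_0 by (cases n) auto
  then obtain d where d: "n = Suc d" using not0_implies_Suc by blast
  have "pspan d - {\<zero>} \<subseteq> alg_type" using not_less_Least[of d "\<lambda>n. \<not> pspan n - {\<zero>} \<subseteq> alg_type"] d n_def by auto
  moreover obtain Q where "Q \<in> pspan (Suc d) - {\<zero>}" "Q \<notin> alg_type" using n d by blast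
  ultimately have "key_polynomial L v K x d Q" by unfold_locales auto
  with that show thesis by blast
qed

context key_polynomial
begin

abbreviation "V \<equiv> pspan d - {\<zero>}"

lemma V_nz: "b \<in> V \<Longrightarrow> b \<in> nz"
  by (rule pspan_nz)

lemma Q_nz: "Q \<in> nz"
  using Q_pspan Q_nonzero pspan_carrier by blast

lemma Q_not_V: "Q \<notin> pspan d"
  using Q_nonzero Q_type pspan_type by blast

text \<open>Constants are of algebraic type, so \<open>Q\<close> is not constant. As a consequence
  \<open>V\<close> contains the nonzero constants.\<close>

lemma d_pos: "d > 0"
proof (rule ccontr)
  assume "\<not> d > 0"
  then have "Q \<in> K" using Q_pspan pspan_1 by simp
  then show False using Knz_alg_type[of Q] Q_nonzero Q_type by blast
qed

lemma Knz_V: "Knz \<subseteq> V"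
  using pspan_mono[of 1 d] pspan_1 d_pos by auto

lemma Q_pow_type: "n > 0 \<Longrightarrow> Q [^] (n::nat) \<notin> alg_type"
  using alg_type_root[OF Q_nz] Q_type by blast

lemma mult_Q_type: assumes "a \<in> alg_type" shows "a \<otimes> Q \<notin> alg_type"
proof
  assume "a \<otimes> Q \<in> alg_type"
  then have "(a \<otimes> Q) \<otimes> inv a \<in> alg_type" using alg_type_mult alg_type_inv assms by blast
  moreover have "(a \<otimes> Q) \<otimes> inv a = Q"
    using alg_type_nz[OF assms] Q_nz m_comm[of a Q] mult_inv_cancel(2)[of Q a] by simp
  ultimately show False using Q_type by simp
qed

section \<open>The group \<open>G\<close>\<close>

definition "G = {u \<otimes> b | u b. u \<in> one_units \<and> b \<in> V}"

lemma GI: "\<lbrakk>u \<in> one_units; b \<in> V\<rbrakk> \<Longrightarrow> u \<otimes> b \<in> G"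
  unfolding G_def by blast

lemma GE: assumes "g \<in> G" obtains u b where "u \<in> one_units" "b \<in> V" "g = u \<otimes> b"
  using assms unfolding G_def by blast

lemma G_nz: "g \<in> G \<Longrightarrow> g \<in> nz"
  by (elim GE) (simp add: nz_mult[OF one_units_nz V_nz, simplified])

lemma G_type: "G \<subseteq> alg_type"
proof
  fix g assume "g \<in> G"
  then obtain u b where "u \<in> one_units" "b \<in> V" "g = u \<otimes> b" by (rule GE)
  then show "g \<in> alg_type" using alg_type_mult alg_units_type one_units_alg pspan_type by blast
qed

lemma V_G: assumes "b \<in> V" shows "b \<in> G"
  using GI[OF one_units_one assms] V_nz[OF assms] by simp

lemma G_one_units_mult: assumes "u \<in> one_units" "g \<in> G" shows "u \<otimes> g \<in> G"
proof -
  obtain w b where wb: "w \<in> one_units" "b \<in> V" "g = w \<otimes> b" using assms(2) by (rule GE)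
  have "u \<otimes> g = (u \<otimes> w) \<otimes> b" unfolding wb(3) using one_units_nz wb assms(1) V_nz[OF wb(2)] by (simp add: m_assoc)
  then show ?thesis using GI[OF one_units_mult[OF assms(1) wb(1)] wb(2)] by simp
qed

lemma G_one: "\<one> \<in> G"
  using V_G Knz_V K_ring(3) by auto

text \<open>A product of two elements of \<open>V\<close> is divided by \<open>Q\<close>; the quotient term is negligible, being a
  multiple of \<open>Q\<close>.\<close>

lemma V_mult: assumes "f \<in> V" "g \<in> V" shows "f \<otimes> g \<in> G"
proof -
  have fg: "f \<otimes> g \<in> pspan (d + (d - 1))" using pspan_mult[of f d g "d - 1"] assms d_pos by simp
  then have "f \<otimes> g \<in> pspan (d + d)" using pspan_mono[of "d + (d - 1)" "d + d"] by auto
  \<comment> \<open>The quotient \<open>a\<close> has degree below \<open>d\<close> again, so it is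
    zero or of algebraic type; this is what makes \<open>a Q\<close> fail to be of algebraic
    type.\<close>
  then obtain a b where ab: "a \<in> pspan d" "b \<in> pspan d" "f \<otimes> g = a \<otimes> Q \<oplus> b"
    using pspan_division[of Q d "f \<otimes> g" d] Q_pspan Q_not_V by blast
  note fgn = nz_mult[OF V_nz[OF assms(1)] V_nz[OF assms(2)]]
  have fgt: "f \<otimes> g \<in> alg_type" using alg_type_mult pspan_type assms by blast
  have c: "a \<in> carrier L" "b \<in> carrier L" using ab pspan_carrier by blast+
  show ?thesis
  proof (cases "a = \<zero>")
    case True
    then have "f \<otimes> g = b" using ab(3) c Q_nz by simp
    then show ?thesis using V_G[of b] ab(2) fgn by simp
  next
    case False
    then have at: "a \<in> alg_type" using ab pspan_type by blast
    have b0: "b \<noteq> \<zero>"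
    proof
      assume "b = \<zero>"
      then have "f \<otimes> g = a \<otimes> Q" using ab(3) c Q_nz by simp
      then show False using mult_Q_type[OF at] fgt by simp
    qed
    then have bV: "b \<in> V" using ab by blast
    have "b \<oplus> a \<otimes> Q = f \<otimes> g" using ab(3) c Q_nz by (simp add: a_comm)
    then obtain u where "u \<in> one_units" "f \<otimes> g = u \<otimes> b"
      using sum_not_alg_type[of b "a \<otimes> Q"] bV pspan_type nz_mult[OF alg_type_nz[OF at] Q_nz] mult_Q_type[OF at] fgt
      by auto
    then show ?thesis using GI bV by simp
  qed
qed

lemma G_mult: assumes "f \<in> G" "g \<in> G" shows "f \<otimes> g \<in> G"
proof -
  obtain u b where f: "u \<in> one_units" "b \<in> V" "f = u \<otimes> b" using assms(1) by (rule GE)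
  obtain u' b' where g: "u' \<in> one_units" "b' \<in> V" "g = u' \<otimes> b'" using assms(2) by (rule GE)
  have "f \<otimes> g = (u \<otimes> u') \<otimes> (b \<otimes> b')" unfolding f(3) g(3)
    using one_units_nz f(1) g(1) V_nz[OF f(2)] V_nz[OF g(2)] by (simp add: m_ac)
  then show ?thesis using G_one_units_mult[OF one_units_mult[OF f(1) g(1)] V_mult[OF f(2) g(2)]] by simp
qed

text \<open>Euclidean descent: dividing \<open>Q\<close> by \<open>f\<close> gives a remainder that is, up to a 1-unit and sign, a
  multiple of \<open>f\<close>.\<close>

lemma V_inv: "\<lbrakk>k \<le> d; f \<in> pspan k - {\<zero>}\<rbrakk> \<Longrightarrow> inv f \<in> G"
proof (induct k arbitrary: f)
  case 0 then show ?case using pspan_0 by simp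
next
  case (Suc k)
  show ?case
  proof (cases "f \<in> pspan k")
    case True then show ?thesis using Suc by simp
  next
    case False
    show ?thesis
    proof (cases "k = 0")
      case True
      then have "f \<in> Knz" using Suc pspan_1 by simp
      then show ?thesis using Knz_inv Knz_V V_G by blast
    next
      case k: False
      have fV: "f \<in> V" using Suc(2,3) pspan_mono[of "Suc k" d] by blast
      note fn = V_nz[OF fV]
      have "Q \<in> pspan ((Suc d - k) + k)" using Q_pspan Suc(2) by simp
      then obtain a b where ab: "a \<in> pspan (Suc d - k)" "b \<in> pspan k" "Q = a \<otimes> f \<oplus> b"
        using pspan_division[of f k Q "Suc d - k"] Suc(3) False by blast
      \<comment> \<open>Constants were split off because \<open>k > 0\<close> is needed here: the
        quotient then has degree at most \<open>d - k\<close>, hence below \<open>d\<close>.\<close>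
      have "Suc d - k \<le> d" using k by simp
      then have ad: "a \<in> pspan d" using ab(1) pspan_mono[of "Suc d - k" d] by blast
      have bd: "b \<in> pspan d" using ab(2) pspan_mono[of k d] Suc(2) by auto
      have c: "a \<in> carrier L" "b \<in> carrier L" using ab pspan_carrier by blast+
      have a0: "a \<noteq> \<zero>"
      proof
        assume "a = \<zero>"
        then have "Q = b" using ab(3) c fn by simp
        then show False using bd Q_not_V by simp
      qed
      then have aV: "a \<in> V" using ad by blast
      note an = V_nz[OF aV]
      have aft: "a \<otimes> f \<in> alg_type" using alg_type_mult aV fV pspan_type by blast
      have b0: "b \<noteq> \<zero>"
      proof
        assume "b = \<zero>"
        then have "Q = a \<otimes> f" using ab(3) c fn by simp
        then show False using aft Q_type by simp
      qed
      define m where "m = \<ominus> b"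
      have mk: "m \<in> pspan k - {\<zero>}" unfolding m_def using pspan_props(4)[OF ab(2)] nz_minus[of b] c b0 by blast
      have mt: "m \<in> alg_type" using mk pspan_type pspan_mono[of k d] Suc(2) by auto
      note mn = alg_type_nz[OF mt]
      have "f \<in> carrier L" using fn by blast
      \<comment> \<open>Arranged so that \<open>Q\<close> is the summand not of algebraic type. The
        inverse of \<open>m\<close> is known by induction, as \<open>m\<close> has degree below
        \<open>k\<close>.\<close>
      then have "m \<oplus> Q = a \<otimes> f" unfolding m_def ab(3) using c by algebra
      then obtain u where u: "u \<in> one_units" "a \<otimes> f = u \<otimes> m"
        using sum_not_alg_type[OF mt Q_nz Q_type] aft by auto
      note un = one_units_nz[OF u(1)]
      have im: "inv m \<in> G" using Suc(1)[OF _ mk] Suc(2) by simp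
      have "inv u \<otimes> (a \<otimes> inv m) \<in> G"
        using G_one_units_mult[OF one_units_inv[OF u(1)] G_mult[OF V_G[OF aV] im]] .
      moreover have "inv f = inv u \<otimes> (a \<otimes> inv m)"
      proof -
        have "inv a \<otimes> inv f = inv u \<otimes> inv m" using inv_mult_nz[OF an fn] inv_mult_nz[OF un mn] u(2) by simp
        then have "a \<otimes> (inv a \<otimes> inv f) = a \<otimes> (inv u \<otimes> inv m)" by simp
        moreover have "a \<otimes> (inv a \<otimes> inv f) = inv f"
          using an nz_inv[OF an] nz_inv[OF fn] by (simp add: m_assoc[symmetric])
        moreover have "a \<otimes> (inv u \<otimes> inv m) = inv u \<otimes> (a \<otimes> inv m)"
          using an nz_inv[OF un] nz_inv[OF mn] by (simp add: m_lcomm)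
        ultimately show ?thesis by simp
      qed
      ultimately show ?thesis by simp
    qed
  qed
qed

lemma G_inv: assumes "g \<in> G" shows "inv g \<in> G"
proof -
  obtain u b where ub: "u \<in> one_units" "b \<in> V" "g = u \<otimes> b" using assms by (rule GE)
  have "inv g = inv u \<otimes> inv b" unfolding ub(3) by (rule inv_mult_nz[OF one_units_nz[OF ub(1)] V_nz[OF ub(2)]])
  then show ?thesis using G_one_units_mult[OF one_units_inv[OF ub(1)] V_inv[OF _ ub(2)]] by simp
qed

lemma G_pow: "g \<in> G \<Longrightarrow> g [^] (n::nat) \<in> G"
  by (induct n) (auto simp: G_one G_mult)

section \<open>The residue field \<open>E\<close> of \<open>G\<close>\<close>

definition "E = res ` (pspan d \<inter> \<O>)"

lemma res_G: assumes "g \<in> G" "v g = 0" shows "res g \<in> E"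
proof -
  obtain u b where ub: "u \<in> one_units" "b \<in> V" "g = u \<otimes> b" using assms(1) by (rule GE)
  note un = one_units_nz[OF ub(1)] and bn = V_nz[OF ub(2)]
  have "v b = 0" using val_mult[OF un bn] val_one_units[OF ub(1)] ub(3) assms(2) by simp
  then have bO: "b \<in> \<O>" using bn by simp
  have "u \<in> \<O>" "res u = \<one>\<^bsub>F\<^esub>" using ub(1) val_units_O unfolding one_units_def by blast+
  then have "res g = res b" unfolding ub(3) using res_mult[of u b] bO res_closed[OF bO] by simp
  then show ?thesis unfolding E_def using ub(2) bO by blast
qed

lemma E_nonzeroE:
  assumes "y \<in> E" "y \<noteq> \<zero>\<^bsub>F\<^esub>" obtains g where "g \<in> G" "g \<in> val_units" "y = res g"
proof -
  obtain b where b: "b \<in> pspan d" "b \<in> \<O>" "y = res b" using assms(1) unfolding E_def by blast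
  have u: "b \<in> val_units" using val_units_iff[OF b(2)] assms(2) b(3) by simp
  then have "b \<in> G" using V_G b(1) val_units_nz by blast
  with u b(3) that show thesis by blast
qed

text \<open>Two descriptions are combined. As residues of the \<open>K\<close>-space
  \<open>pspan d\<close>, the elements of \<open>E\<close> are closed under sums; its nonzero
  elements are residues of units in the group \<open>G\<close>, which gives products and
  inverses.\<close>

lemma subfield_E: "subfield E F"
proof (rule F.subfieldI'[OF F.subringI])
  show "E \<subseteq> carrier F" unfolding E_def using res_closed by blast
  show "\<one>\<^bsub>F\<^esub> \<in> E" using res_G[OF G_one] res_one by simp
next
  fix h assume "h \<in> E"
  then obtain b where b: "b \<in> pspan d" "b \<in> \<O>" "h = res b" unfolding E_def by blast
  then have "\<ominus> b \<in> pspan d \<inter> \<O>" using pspan_props(4) O_closed(3) by blast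
  then show "\<ominus>\<^bsub>F\<^esub> h \<in> E" unfolding E_def b(3) res_minus[OF b(2), symmetric] by (rule imageI)
next
  fix y z assume yz: "y \<in> E" "z \<in> E"
  then obtain a b where b: "a \<in> pspan d" "a \<in> \<O>" "y = res a" "b \<in> pspan d" "b \<in> \<O>" "z = res b" unfolding E_def by blast
  then have "a \<oplus> b \<in> pspan d \<inter> \<O>" using pspan_props(3) O_closed(5) by blast
  then show "y \<oplus>\<^bsub>F\<^esub> z \<in> E" unfolding E_def b(3,6) res_add[OF b(2,5), symmetric] by (rule imageI)
  have c: "y \<in> carrier F" "z \<in> carrier F" using b res_closed by blast+
  have "\<zero> \<in> pspan d \<inter> \<O>" using pspan_props(2) O_closed(1) by blast
  then have E0: "\<zero>\<^bsub>F\<^esub> \<in> E" unfolding E_def using imageI[of \<zero> "pspan d \<inter> \<O>" res] res_zero by simp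
  show "y \<otimes>\<^bsub>F\<^esub> z \<in> E"
  proof (cases "y = \<zero>\<^bsub>F\<^esub> \<or> z = \<zero>\<^bsub>F\<^esub>")
    case True then show ?thesis using c E0 by auto
  next
    case False
    obtain g where g: "g \<in> G" "g \<in> val_units" "y = res g" using E_nonzeroE[OF yz(1)] False by blast
    obtain h where h: "h \<in> G" "h \<in> val_units" "z = res h" using E_nonzeroE[OF yz(2)] False by blast
    have "v (g \<otimes> h) = 0" using val_units_mult[OF g(2) h(2)] by (simp add: val_units_def)
    then show ?thesis using res_G[OF G_mult[OF g(1) h(1)]] res_mult[OF val_units_O[OF g(2)] val_units_O[OF h(2)]]
      g(3) h(3) by simp
  qed
next
  fix y assume "y \<in> E - {\<zero>\<^bsub>F\<^esub>}"
  then obtain g where g: "g \<in> G" "g \<in> val_units" "y = res g" using E_nonzeroE[of y] by blast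
  have "v (inv g) = 0" using val_units_inv[OF g(2)] by (simp add: val_units_def)
  then show "inv\<^bsub>F\<^esub> y \<in> E" using res_G[OF G_inv[OF g(1)]] res_inv[OF g(2)] g(3) by simp
qed

lemma Kv_E: "Kv \<subseteq> E"
  unfolding residue_subfield_eq E_def using pspan_mono[of 1 d] pspan_1 d_pos by auto

lemma finite_dimension_E: "F.finite_dimension Kv E"
proof -
  obtain Bs where "F.independent Kv Bs" "F.Span Kv Bs = E"
    by (rule Span_residues_finite_dimension[OF exp_base_carrier[of d]]) (auto simp: E_def pspan_def)
  then show ?thesis using F.finite_dimensionI[OF F.dimensionI[OF Kv]] by blast
qed

lemma Q_pow_nz: "Q [^] (n::nat) \<in> nz"
  by (rule nz_pow[OF Q_nz])

text \<open>Write \<open>f = a Q + b\<close> and \<open>w = a Q / b\<close>. If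
  \<open>v w > 0\<close>, then \<open>b\<close> dominates; if \<open>v w < 0\<close>, then
  \<open>a Q\<close> does; if \<open>v w = 0\<close>, then \<open>1 + w\<close> has to be a unit,
  and this is what \<open>step\<close> guarantees. The set \<open>R\<close> restricts the residues
  of the unit factor and is the only thing that varies: it is \<open>{1}\<close> when
  \<open>v Q\<close> is independent of the values of \<open>G\<close>, and \<open>E[t]\<close>
  otherwise.\<close>

lemma Q_adic_leading_term:
  assumes R1: "\<one>\<^bsub>F\<^esub> \<in> R"
    and step: "\<And>u g i. \<lbrakk>u \<in> val_units; res u \<in> R; g \<in> G; v (u \<otimes> g \<otimes> Q [^] Suc i) = 0\<rbrakk>
      \<Longrightarrow> \<one>\<^bsub>F\<^esub> \<oplus>\<^bsub>F\<^esub> res (u \<otimes> g \<otimes> Q [^] Suc i) \<in> R - {\<zero>\<^bsub>F\<^esub>}"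
  shows "f \<in> pspan n - {\<zero>} \<Longrightarrow>
    \<exists>u g i. u \<in> val_units \<and> res u \<in> R \<and> g \<in> G \<and> f = u \<otimes> g \<otimes> Q [^] (i::nat)"
proof (induct n arbitrary: f rule: less_induct)
  case (less n)
  have inG: ?case if "f \<in> G"
  proof -
    have "f = \<one> \<otimes> f \<otimes> Q [^] (0::nat)" using G_nz[OF that] by simp
    then show ?thesis using that val_units_one R1 res_one by metis
  qed
  show ?case
  proof (cases "n \<le> d")
    case True
    then have "f \<in> V" using less(2) pspan_mono[of n d] by blast
    then show ?thesis using inG V_G by blast
  next
    case False
    define m where "m = n - d"
    have mn: "n = m + d" "m < n" using False d_pos by (auto simp: m_def)
    obtain a b where ab: "a \<in> pspan m" "b \<in> pspan d" "f = a \<otimes> Q \<oplus> b"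
      using pspan_division[of Q d f m] Q_pspan Q_not_V less(2) mn(1) by blast
    have c: "a \<in> carrier L" "b \<in> carrier L" using ab pspan_carrier by blast+
    show ?thesis
    proof (cases "a = \<zero>")
      case True
      then have "f = b" using ab(3) c Q_nz by simp
      then show ?thesis using inG V_G ab(2) less(2) by blast
    next
      case False
      then obtain u g i where ugi: "u \<in> val_units" "res u \<in> R" "g \<in> G" "a = u \<otimes> g \<otimes> Q [^] (i::nat)"
        using less(1)[OF mn(2), of a] ab(1) by blast
      note un = val_units_nz[OF ugi(1)] and gn = G_nz[OF ugi(3)]
      have aQ: "a \<otimes> Q = u \<otimes> g \<otimes> Q [^] Suc i" unfolding ugi(4) using un gn Q_nz by (simp add: m_assoc)
      show ?thesis
      proof (cases "b = \<zero>")
        case True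
        then have "f = a \<otimes> Q" using ab(3) c Q_nz by simp
        then have "f = u \<otimes> g \<otimes> Q [^] Suc i" using aQ by simp
        then show ?thesis using ugi by blast
      next
        case b0: False
        then have bV: "b \<in> V" using ab by blast
        note bn = V_nz[OF bV]
        define g' where "g' = g \<otimes> inv b"
        have g': "g' \<in> G" unfolding g'_def using G_mult[OF ugi(3) G_inv[OF V_G[OF bV]]] .
        define w where "w = u \<otimes> g' \<otimes> Q [^] Suc i"
        have wn: "w \<in> nz" unfolding w_def using nz_mult[OF nz_mult[OF un G_nz[OF g']] Q_pow_nz] .
        have wb: "a \<otimes> Q = w \<otimes> b"
        proof -
          have "g = g' \<otimes> b" unfolding g'_def using mult_inv_cancel(1)[of g b] gn bn by simp
          then show ?thesis unfolding aQ w_def using un G_nz[OF g'] bn Q_pow_nz[of "Suc i"] by (simp add: m_ac del: nat_pow_Suc)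
        qed
        have f1: "f = (\<one> \<oplus> w) \<otimes> b" unfolding ab(3) wb using wn bn by (simp add: l_distr a_comm)
        consider "v w > 0" | "v w < 0" | "v w = 0" by fastforce
        then show ?thesis
        proof cases
          case 1
          then have "f \<in> G" unfolding f1 using GI[OF one_unitsI[OF wn] bV] by blast
          then show ?thesis by (rule inG)
        next
          case 2
          \<comment> \<open>The correction to the dominating term \<open>a Q\<close> is a 1-unit,
            which is absorbed into \<open>g\<close>.\<close>
          define z where "z = \<one> \<oplus> inv w"
          have z: "z \<in> one_units" unfolding z_def using one_unitsI[OF nz_inv[OF wn]] val_inv[OF wn] 2 by simp
          have "w \<otimes> z = \<one> \<oplus> w" unfolding z_def using wn nz_inv[OF wn] by (simp add: r_distr a_comm)
          then have "f = z \<otimes> (a \<otimes> Q)" unfolding f1 wb using wn one_units_nz[OF z] bn by (simp add: m_ac)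
          also have "\<dots> = u \<otimes> (z \<otimes> g) \<otimes> Q [^] Suc i" unfolding aQ
            using un gn one_units_nz[OF z] Q_pow_nz[of "Suc i"] by (simp add: m_ac del: nat_pow_Suc)
          finally show ?thesis using ugi(1,2) G_one_units_mult[OF z ugi(3)] by blast
        next
          case 3
          then have wO: "w \<in> \<O>" using wn by simp
          have s: "\<one>\<^bsub>F\<^esub> \<oplus>\<^bsub>F\<^esub> res w \<in> R - {\<zero>\<^bsub>F\<^esub>}"
            unfolding w_def by (rule step[OF ugi(1,2) g']) (use 3 w_def in simp)
          have r: "res (\<one> \<oplus> w) = \<one>\<^bsub>F\<^esub> \<oplus>\<^bsub>F\<^esub> res w" using res_add[OF O_closed(2) wO] res_one by simp
          have "\<one> \<oplus> w \<in> val_units" using val_units_iff[OF O_closed(5)[OF O_closed(2) wO]] s r by simp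
          moreover have "res (\<one> \<oplus> w) \<in> R" using s r by simp
          \<comment> \<open>The power of \<open>Q\<close> disappears into the new unit
            \<open>1 + w\<close>, and \<open>b\<close> takes the place of \<open>g\<close>.\<close>
          moreover have "f = (\<one> \<oplus> w) \<otimes> b \<otimes> Q [^] (0::nat)" unfolding f1 using wn bn by simp
          ultimately show ?thesis using V_G[OF bV] by blast
        qed
      qed
    qed
  qed
qed

lemma val_G: "v ` G \<subseteq> vL"
  unfolding value_set_def using G_nz by blast

lemma subgroup_val_G: "subgroup (v ` G) (add_grp UNIV)"
  using G_nz by (intro subgroup_val_image G_one G_mult G_inv) auto

lemma vK_val_G: "vK \<subseteq> v ` G"
  unfolding value_set_def using Knz_V V_G by blast

lemma val_G_finite:
  obtains S where "finite S" "S \<subseteq> nz" "\<And>g. g \<in> G \<Longrightarrow> \<exists>s\<in>S. \<exists>c\<in>Knz. v g = v s + v c"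
proof -
  obtain S where S: "finite S" "S \<subseteq> V" "\<And>f. f \<in> V \<Longrightarrow> \<exists>s\<in>S. \<exists>c\<in>Knz. v f = v s + v c"
    using pspan_values_finite[of d] by metis
  have "\<exists>s\<in>S. \<exists>c\<in>Knz. v g = v s + v c" if gG: "g \<in> G" for g
  proof -
    obtain u b where ub: "u \<in> one_units" "b \<in> V" "g = u \<otimes> b" using gG by (rule GE)
    have "v g = v b" using val_mult[OF one_units_nz[OF ub(1)] V_nz[OF ub(2)]] val_one_units[OF ub(1)] ub(3) by simp
    then show ?thesis using S(3)[OF ub(2)] by simp
  qed
  moreover have "S \<subseteq> nz" using S(2) V_nz by blast
  ultimately show thesis using that S(1) by blast
qed

end

subsection \<open>The three cases\<close>

text \<open>If \<open>s = p(t)\<close>, then \<open>t\<close> is a root of \<open>X p - 1\<close>.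
  So a transcendental \<open>t\<close> is not invertible in the polynomial ring that it generates,
  which later excludes \<open>1 + s t = 0\<close>.\<close>

lemma (in domain) algebraic_if_inverse_in_simple_extension:
  assumes K: "subring K R" and t: "t \<in> carrier R" and s: "s \<in> simple_extension K t" "s \<otimes> t = \<one>"
  shows "(algebraic over K) t"
proof -
  note Kr = subringE[OF K]
  obtain p where p: "p \<in> carrier (K[X])" "s = eval p t"
    using s(1) simple_extension_as_eval_img[OF Kr(1) t] by auto
  have pK: "set p \<subseteq> K" "p \<noteq> [] \<Longrightarrow> lead_coeff p \<noteq> \<zero>" using p(1) unfolding univ_poly_def polynomial_def by auto
  have "p \<noteq> []"
  proof
    assume "p = []"
    then have "s = \<zero>" using p by simp
    then show False using s t by simp
  qed
  \<comment> \<open>This list represents \<open>X p - 1\<close> and inherits the leading coefficient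
    of \<open>p\<close>.\<close>
  then have "p @ [\<ominus> \<one>] \<in> carrier (K[X])" using pK Kr(3,5) unfolding univ_poly_def polynomial_def by auto
  moreover have "eval (p @ [\<ominus> \<one>]) t = s \<otimes> t \<oplus> \<ominus> \<one>"
    unfolding p(2) by (rule eval_append_aux) (use pK Kr(1) t in auto)
  then have "eval (p @ [\<ominus> \<one>]) t = \<zero>" using s(2) by (simp add: r_neg)
  ultimately show ?thesis using algebraicI[of "p @ [\<ominus> \<one>]" K t] by simp
qed

section \<open>The two cases with a key polynomial\<close>

context key_polynomial
begin

lemma finite_quotient_val_G: "finite_group_extension vK (v ` G)"
proof -
  interpret A: group_pair vK "v ` G" by (rule group_pair.intro[OF subgroup_vK subgroup_val_G vK_val_G])
  obtain S where S: "finite S" "\<And>g. g \<in> G \<Longrightarrow> \<exists>s\<in>S. \<exists>c\<in>Knz. v g = v s + v c"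
    using val_G_finite by metis
  have "\<exists>s\<in>v ` S. \<exists>a\<in>vK. c = s + a" if "c \<in> v ` G" for c
    using that S(2) unfolding value_set_def by blast
  then have "carrier (add_grp (v ` G) Mod vK) \<subseteq> (\<lambda>s. (\<lambda>a. a + s) ` vK) ` (v ` S)"
    by (rule A.carrier_quotient_subset)
  then have "finite (carrier (add_grp (v ` G) Mod vK))" by (rule finite_subset) (use S(1) in simp)
  then show ?thesis unfolding finite_group_extension_def using subgroup_vK subgroup_val_G vK_val_G by blast
qed

text \<open>Two parts of equal value would make a positive multiple of \<open>v Q\<close> a value of
  \<open>G\<close>, so the hypothesis on equal values in the leading-term argument holds vacuously.
  All units that occur are 1-units and are absorbed into \<open>G\<close>.\<close>

lemma value_transcendental_form:
  assumes indep: "\<And>n g. \<lbrakk>n > (0::nat); g \<in> G\<rbrakk> \<Longrightarrow> v (Q [^] n) \<noteq> v g" and r: "r \<in> nz"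
  obtains g i j where "g \<in> G" "r = g \<otimes> Q [^] (i::nat) \<otimes> inv (Q [^] (j::nat))"
proof -
  have step: "\<one>\<^bsub>F\<^esub> \<oplus>\<^bsub>F\<^esub> res (u \<otimes> g \<otimes> Q [^] Suc i) \<in> {\<one>\<^bsub>F\<^esub>} - {\<zero>\<^bsub>F\<^esub>}"
    if h: "u \<in> val_units" "res u \<in> {\<one>\<^bsub>F\<^esub>}" "g \<in> G" "v (u \<otimes> g \<otimes> Q [^] Suc i) = 0" for u g i
  proof -
    note un = val_units_nz[OF h(1)] and gn = G_nz[OF h(3)]
    have "v (u \<otimes> g \<otimes> Q [^] Suc i) = v g + v (Q [^] Suc i)"
      using val_mult[OF nz_mult[OF un gn] Q_pow_nz, of "Suc i"] val_mult[OF un gn] h(1) by (simp add: val_units_def)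
    then have "v (Q [^] Suc i) = v (inv g)" using val_inv_eqI[OF gn] h(4) add.commute by metis
    then show ?thesis using indep[of "Suc i" "inv g"] G_inv[OF h(3)] by blast
  qed
  have form: "\<exists>g\<in>G. \<exists>i::nat. f = g \<otimes> Q [^] i" if f: "f \<in> pspan n - {\<zero>}" for f n
  proof -
    obtain u g i where h: "u \<in> val_units" "res u \<in> {\<one>\<^bsub>F\<^esub>}" "g \<in> G" "f = u \<otimes> g \<otimes> Q [^] (i::nat)"
      using Q_adic_leading_term[OF _ step f] by blast
    then have "u \<otimes> g \<in> G" using G_one_units_mult[of u g] by (simp add: one_units_def)
    with h(4) show ?thesis by blast
  qed
  obtain n f f' where ff: "f \<in> pspan n - {\<zero>}" "f' \<in> pspan n - {\<zero>}" "r = f \<otimes> inv f'"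
    by (rule fraction_pspan_nz[OF r])
  obtain g i where g: "g \<in> G" "f = g \<otimes> Q [^] (i::nat)" using form[OF ff(1)] by blast
  obtain h j where h: "h \<in> G" "f' = h \<otimes> Q [^] (j::nat)" using form[OF ff(2)] by blast
  have c: "g \<in> carrier L" "inv h \<in> carrier L" "Q [^] i \<in> carrier L" "inv (Q [^] j) \<in> carrier L"
    using G_nz[OF g(1)] nz_inv[OF G_nz[OF h(1)]] Q_pow_nz[of i] nz_inv[OF Q_pow_nz[of j]] by blast+
  have "r = (g \<otimes> inv h) \<otimes> Q [^] i \<otimes> inv (Q [^] j)"
    unfolding ff(3) g(2) h(2) inv_mult_nz[OF G_nz[OF h(1)] Q_pow_nz] using c by algebra
  then show thesis using that G_mult[OF g(1) G_inv[OF h(1)]] by blast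
qed

text \<open>If \<open>g Q^i / Q^j\<close> has value zero, then \<open>i = j\<close>, as otherwise a
  positive multiple of \<open>v Q\<close> would be a value of \<open>G\<close>. So all units lie in
  \<open>G\<close>, and the residue field is \<open>E\<close> itself.\<close>

lemma value_transcendental_residue_field:
  assumes indep: "\<And>n g. \<lbrakk>n > (0::nat); g \<in> G\<rbrakk> \<Longrightarrow> v (Q [^] n) \<noteq> v g"
  shows "F.finite_dimension Kv (carrier F)"
proof -
  have "carrier F \<subseteq> E"
  proof
    fix y assume "y \<in> carrier F"
    then obtain r where r: "r \<in> \<O>" "y = res r" unfolding carrier_F by blast
    show "y \<in> E"
    proof (cases "r \<in> val_units")
      case False
      then have "y = \<zero>\<^bsub>F\<^esub>" using val_units_iff[OF r(1)] r(2) by simp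
      then show ?thesis using subringE(2)[OF subfieldE(1)[OF subfield_E]] by simp
    next
      case True
      then have r0: "r \<in> nz" "v r = 0" by (auto simp: val_units_def)
      obtain g i j where g: "g \<in> G" "r = g \<otimes> Q [^] (i::nat) \<otimes> inv (Q [^] (j::nat))"
        by (rule value_transcendental_form[OF indep r0(1)])
      note gn = G_nz[OF g(1)]
      have "v r = v g + v (Q [^] i) + - v (Q [^] j)"
        using val_mult[OF nz_mult[OF gn Q_pow_nz] nz_inv[OF Q_pow_nz], of i j] val_mult[OF gn Q_pow_nz] val_inv[OF Q_pow_nz]
          g(2) by simp
      then have e: "v g + v (Q [^] i) = v (Q [^] j)" using r0(2) by simp
      have split: "v (Q [^] (a + b)) = v (Q [^] a) + v (Q [^] b)" for a b :: nat
        using val_mult[OF Q_pow_nz Q_pow_nz, of a b] Q_nz by (simp add: nat_pow_mult)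
      have "i = j"
      proof (rule linorder_cases[of i j])
        assume "i < j"
        then have "v (Q [^] (j - i)) = v g" using split[of "j - i" i] e by simp
        then show ?thesis using indep[of "j - i" g] g(1) \<open>i < j\<close> by simp
      next
        assume "j < i"
        then have "v (Q [^] (i - j)) + v g = 0" using split[of "i - j" j] e by (simp add: algebra_simps)
        then have "v (Q [^] (i - j)) = v (inv g)" by (rule val_inv_eqI[OF gn])
        then show ?thesis using indep[of "i - j" "inv g"] G_inv[OF g(1)] \<open>j < i\<close> by simp
      qed
      then have "r = g" using g(2) mult_inv_cancel(2)[OF _ Q_pow_nz] gn by simp
      then show ?thesis using res_G[OF g(1)] r0(2) r(2) by simp
    qed
  qed
  then have "carrier F = E" using subfieldE(3)[OF subfield_E] by blast
  then show ?thesis using finite_dimension_E by simp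
qed

text \<open>The values of \<open>G\<close> and the multiples of \<open>v Q\<close> generate
  \<open>vL\<close> by the normal form, and \<open>indep\<close> makes their sum direct. The map
  \<open>k\<close> goes from the product to \<open>vL\<close>, where a formula is available, and is
  inverted at the end.\<close>

lemma value_transcendental_value_group:
  assumes indep: "\<And>n g. \<lbrakk>n > (0::nat); g \<in> G\<rbrakk> \<Longrightarrow> v (Q [^] n) \<noteq> v g"
  shows "iso_sum_integers_over vK (v ` G) vL"
proof -
  interpret Z: comm_group "add_grp (UNIV :: 'g set)" by (rule group_add_grp)
  interpret B: group_pair vK "v ` G" by (rule group_pair.intro[OF subgroup_vK subgroup_val_G vK_val_G])
  \<comment> \<open>The integer multiple \<open>i v Q\<close>, in the power notation of the additive
    group.\<close>
  define q where "q i = v Q [^]\<^bsub>add_grp UNIV\<^esub> (i::int)" for i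
  have inv_Z: "inv\<^bsub>add_grp UNIV\<^esub> a = - a" for a :: 'g by (rule Z.inv_equality) auto
  have q_add: "q (i + j) = q i + q j" for i j unfolding q_def by (simp add: Z.int_pow_mult)
  have q_diff: "q (i - j) = q i - q j" for i j unfolding q_def by (simp add: Z.int_pow_diff inv_Z)
  have q_nat: "q (int n) = v (Q [^] n)" for n
    unfolding q_def by (simp add: int_pow_int val_pow_add_grp[OF Q_nz])
  have q0: "q 0 = 0" unfolding q_def by simp
  have q_neg: "q (- int n) = v (inv (Q [^] n))" for n
    using q_diff[of 0 "int n"] q_nat[of n] val_inv[OF Q_pow_nz, of n] q0 by simp
  have q_vL: "q i \<in> vL" for i
  proof (cases i rule: int_cases)
    case (nonneg n) then show ?thesis using q_nat[of n] Q_pow_nz[of n] unfolding value_set_def by (metis imageI)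
  next
    case (neg n) then show ?thesis using q_neg[of "Suc n"] nz_inv[OF Q_pow_nz[of "Suc n"]] unfolding value_set_def by (metis imageI)
  qed
  have q_indep: "i = 0" if g: "q i = v g" "g \<in> G" for i g
  proof (cases i "0 :: int" rule: linorder_cases)
    case less
    then obtain n where "n > 0" "- i = int n" using zero_less_imp_eq_int[of "- i"] by auto
    then have n: "i = - int n" "n > 0" by simp_all
    have "v g = - v (Q [^] n)" using g(1) q_neg[of n] n(1) val_inv[OF Q_pow_nz, of n] by simp
    then have "v (Q [^] n) = v (inv g)" by (intro val_inv_eqI[OF G_nz[OF g(2)]]) simp
    then show ?thesis using indep[OF n(2) G_inv[OF g(2)]] by blast
  next
    case greater
    then obtain n where n: "i = int n" "n > 0" using zero_less_imp_eq_int[of i] by blast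
    then show ?thesis using indep[OF n(2) g(2)] q_nat[of n] g(1) by simp
  qed
  let ?D = "add_grp (v ` G) \<times>\<times> integer_group"
  define k where "k = (\<lambda>(a, i). a + q i)"
  have k: "k (a, i) = a + q i" for a i by (simp add: k_def)
  have vL_add: "a + b \<in> vL" if "a \<in> vL" "b \<in> vL" for a b
    using subgroup.m_closed[OF subgroup_vL that] by simp
  have inj: "inj_on k (v ` G \<times> UNIV)"
  proof (rule inj_onI)
    fix y z assume yz: "y \<in> v ` G \<times> (UNIV::int set)" "z \<in> v ` G \<times> (UNIV::int set)" "k y = k z"
    obtain g i where y: "y = (v g, i)" "g \<in> G" using yz(1) by auto
    obtain h j where z: "z = (v h, j)" "h \<in> G" using yz(2) by auto
    have "v g + q i = v h + q j" using yz(3) y z by (simp add: k)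
    then have e: "q (i - j) = v h - v g" unfolding q_diff by (simp add: algebra_simps)
    have "v h - v g = v (h \<otimes> inv g)"
      using val_mult[OF G_nz[OF z(2)] nz_inv[OF G_nz[OF y(2)]]] val_inv[OF G_nz[OF y(2)]] by simp
    then have "i - j = 0" using q_indep[of "i - j" "h \<otimes> inv g"] e G_mult[OF z(2) G_inv[OF y(2)]] by simp
    then show "y = z" using e q0 y z by simp
  qed
  have img: "k ` (v ` G \<times> UNIV) = vL"
  proof
    show "k ` (v ` G \<times> UNIV) \<subseteq> vL"
    proof
      fix c assume "c \<in> k ` (v ` G \<times> UNIV)"
      then obtain a i where "a \<in> v ` G" "c = a + q i" unfolding k_def by auto
      then show "c \<in> vL" using vL_add[OF _ q_vL] val_G by blast
    qed
    show "vL \<subseteq> k ` (v ` G \<times> UNIV)"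
    proof
      fix c assume "c \<in> vL"
      then obtain r where r: "r \<in> nz" "c = v r" unfolding value_set_def by blast
      obtain g i j where g: "g \<in> G" "r = g \<otimes> Q [^] (i::nat) \<otimes> inv (Q [^] (j::nat))"
        by (rule value_transcendental_form[OF indep r(1)])
      note gn = G_nz[OF g(1)]
      have "v r = v g + v (Q [^] i) + - v (Q [^] j)"
        using val_mult[OF nz_mult[OF gn Q_pow_nz] nz_inv[OF Q_pow_nz], of i j] val_mult[OF gn Q_pow_nz] val_inv[OF Q_pow_nz]
          g(2) by simp
      then have "c = k (v g, int i - int j)" unfolding k q_diff q_nat using r(2) by simp
      then show "c \<in> k ` (v ` G \<times> UNIV)" using g(1) by (intro image_eqI[of _ k "(v g, int i - int j)"]) simp_all
    qed
  qed
  have "k \<in> hom ?D (add_grp vL)"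
  proof (rule homI)
    fix y assume "y \<in> carrier ?D" then show "k y \<in> carrier (add_grp vL)" using img by auto
  next
    fix y z assume "y \<in> carrier ?D" "z \<in> carrier ?D"
    show "k (y \<otimes>\<^bsub>?D\<^esub> z) = k y \<otimes>\<^bsub>add_grp vL\<^esub> k z"
      by (cases y; cases z) (simp add: k q_add algebra_simps)
  qed
  then have "k \<in> iso ?D (add_grp vL)" unfolding iso_def bij_betw_def using inj img by simp
  moreover have "group ?D"
    by (rule DirProd_group) (use B.add_grp_C comm_group.axioms in auto)
  ultimately have "inv_into (carrier ?D) k \<in> iso (add_grp vL) ?D" by (intro group.iso_set_sym)
  moreover have "inv_into (carrier ?D) k a = (a, 0)" if "a \<in> vK" for a
  proof -
    have "a \<in> v ` G" using that vK_val_G by blast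
    then have "inv_into (v ` G \<times> UNIV) k (k (a, 0)) = (a, 0)" by (intro inv_into_f_f[OF inj]) simp
    then show ?thesis using q0 by (simp add: k)
  qed
  ultimately show ?thesis unfolding iso_sum_integers_over_def by blast
qed

text \<open>By minimality of \<open>e\<close>, the exponents \<open>n\<close> for which
  \<open>n v Q\<close> is a value of \<open>G\<close> are the multiples of \<open>e\<close>. Hence
  an expression \<open>u g Q^n\<close> of value zero can be rewritten with a power of
  \<open>w\<close>, which controls residues, and the \<open>i v Q\<close> with \<open>i < e\<close>
  represent all values modulo those of \<open>G\<close>, which bounds the index.\<close>

lemma residue_transcendental_case:
  assumes n0: "n0 > (0::nat)" "g0 \<in> G" "v (Q [^] n0) = v g0"
  shows "finite (carrier (add_grp vL Mod vK)) \<and> rational_over_finite_extension F Kv"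
proof -
  define e where "e = (LEAST n. n > 0 \<and> (\<exists>g\<in>G. v (Q [^] (n::nat)) = v g))"
  have "e > 0 \<and> (\<exists>g\<in>G. v (Q [^] e) = v g)" unfolding e_def by (rule LeastI[of _ n0]) (use n0 in blast)
  then obtain h' where e: "e > 0" "h' \<in> G" "v (Q [^] e) = v h'" by blast
  have least: "\<not> (v (Q [^] n) = v g)" if "0 < n" "n < e" "g \<in> G" for n g
    using not_less_Least[of n "\<lambda>n. n > 0 \<and> (\<exists>g\<in>G. v (Q [^] (n::nat)) = v g)"] that e_def by blast
  define h where "h = inv h'"
  have h: "h \<in> G" unfolding h_def by (rule G_inv[OF e(2)])
  note hn = G_nz[OF h]
  have vh: "v (Q [^] e) = - v h" unfolding h_def using e(3) val_inv[OF G_nz[OF e(2)]] by simp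
  have dvd: "v (Q [^] n) = v g \<Longrightarrow> g \<in> G \<Longrightarrow> e dvd n" for n g
  proof (induct n arbitrary: g rule: less_induct)
    case (less n)
    show ?case
    proof (cases "n = 0")
      case False
      then have en: "e \<le> n" using least[of n g] less(2,3) by fastforce
      have "v (Q [^] n) = v (Q [^] (n - e)) + v (Q [^] e)"
        using val_mult[OF Q_pow_nz Q_pow_nz, of "n - e" e] Q_nz en by (simp add: nat_pow_mult)
      then have "v (Q [^] (n - e)) = v g + v h" using less(2) vh by (simp add: algebra_simps)
      also have "\<dots> = v (g \<otimes> h)" using val_mult[OF G_nz[OF less(3)] hn] by simp
      finally have "e dvd n - e" using less(1)[of "n - e" "g \<otimes> h"] e(1) en G_mult[OF less(3) h] by simp
      then show ?thesis using en by (simp add: dvd_minus_self)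
    qed simp
  qed
  define w where "w = h \<otimes> Q [^] e"
  have wn: "w \<in> nz" unfolding w_def by (rule nz_mult[OF hn Q_pow_nz])
  have w: "w \<in> val_units" using wn val_mult[OF hn Q_pow_nz, of e] vh by (simp add: val_units_def w_def)
  define t where "t = res w"
  have tc: "t \<in> carrier F" unfolding t_def using res_nz[OF w] by blast
  \<comment> \<open>If \<open>t\<close> were algebraic, then \<open>w\<close>, after division by
    \<open>h\<close> also \<open>Q^e\<close>, and finally its root \<open>Q\<close> would be of
    algebraic type.\<close>
  have t_alg: "t \<notin> algs"
  proof
    assume "t \<in> algs"
    then have "w \<in> alg_type" using w alg_units_type unfolding t_def alg_units_def by blast
    then have "inv h \<otimes> w \<in> alg_type" using alg_type_mult alg_type_inv G_type h by blast
    moreover have "inv h \<otimes> w = Q [^] e" unfolding w_def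
      using hn nz_inv[OF hn] Q_pow_nz[of e] by (simp add: m_assoc[symmetric])
    ultimately show False using Q_pow_type[OF e(1)] by simp
  qed
  have transE: "(F.transcendental over E) t"
  proof (rule ccontr)
    assume "\<not> (F.transcendental over E) t"
    then have "(F.algebraic over E) t" by (simp add: over_def)
    then have "(F.algebraic over Kv) t" by (rule F.algebraic_over_finite_extension[OF Kv subfield_E finite_dimension_E tc])
    then show False using t_alg tc unfolding algs_def by blast
  qed
  \<comment> \<open>Each factor \<open>Q^e\<close> is replaced by \<open>w / h\<close>, and the
    powers of \<open>1 / h\<close> are collected in \<open>g'\<close>.\<close>
  have decomp: "\<exists>g' k. g' \<in> G \<and> v g' = 0 \<and> n = e * k \<and> u \<otimes> g \<otimes> Q [^] n = u \<otimes> g' \<otimes> w [^] k"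
    if a: "u \<in> val_units" "g \<in> G" "v (u \<otimes> g \<otimes> Q [^] (n::nat)) = 0" for u g n
  proof -
    note un = val_units_nz[OF a(1)] and gn = G_nz[OF a(2)]
    have "v g + v (Q [^] n) = 0"
      using val_mult[OF nz_mult[OF un gn] Q_pow_nz, of n] val_mult[OF un gn] a(1,3) by (simp add: val_units_def)
    then have "v (Q [^] n) = v (inv g)" using val_inv_eqI[OF gn] add.commute by metis
    then obtain k where k: "n = e * k" using dvd G_inv[OF a(2)] by blast
    define g' where "g' = g \<otimes> inv h [^] k"
    have g': "g' \<in> G" unfolding g'_def by (intro G_mult G_pow G_inv a(2) h)
    have Qe: "inv h \<otimes> w = Q [^] e" unfolding w_def
      using hn nz_inv[OF hn] Q_pow_nz[of e] by (simp add: m_assoc[symmetric])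
    have c: "u \<in> carrier L" "g \<in> carrier L" "inv h \<in> carrier L" "w \<in> carrier L" using un gn nz_inv[OF hn] wn by blast+
    have "Q [^] n = (inv h \<otimes> w) [^] k" unfolding Qe k using Q_nz by (simp add: nat_pow_pow)
    also have "\<dots> = inv h [^] k \<otimes> w [^] k" by (rule nat_pow_distrib[OF c(3,4)])
    finally have eq: "u \<otimes> g \<otimes> Q [^] n = u \<otimes> g' \<otimes> w [^] k" unfolding g'_def using c by (simp add: m_assoc)
    have "v (w [^] k) = 0" using val_units_pow[OF w, of k] by (simp add: val_units_def)
    then have "v (u \<otimes> g' \<otimes> w [^] k) = v g'"
      using val_mult[OF nz_mult[OF un G_nz[OF g']] nz_pow[OF wn], of k] val_mult[OF un G_nz[OF g']] a(1) by (simp add: val_units_def)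
    then have "v g' = 0" using a(3) eq by simp
    with g' k eq show ?thesis by blast
  qed
  have res_decomp: "res (u \<otimes> g' \<otimes> w [^] k) = res u \<otimes>\<^bsub>F\<^esub> res g' \<otimes>\<^bsub>F\<^esub> t [^]\<^bsub>F\<^esub> k"
    if a: "u \<in> val_units" "g' \<in> G" "v g' = 0" for u g' and k :: nat
  proof -
    have g': "g' \<in> val_units" using a G_nz by (simp add: val_units_def)
    show ?thesis unfolding t_def
      using res_mult[OF val_units_O[OF val_units_mult[OF a(1) g']] val_units_O[OF val_units_pow[OF w]], of k]
        res_mult[OF val_units_O[OF a(1)] val_units_O[OF g']] res_pow[OF val_units_O[OF w], of k] by simp
  qed
  let ?R = "F.simple_extension E t"
  note Es = subfieldE(1)[OF subfield_E] and Ec = subfieldE(3)[OF subfield_E]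
  have Rs: "subring ?R F" by (rule F.simple_extension_is_subring[OF Es tc])
  note Rr = subringE[OF Rs]
  have ER: "E \<subseteq> ?R" by (rule F.simple_extension_incl[OF Ec tc])
  have tR: "t \<in> ?R" by (rule F.simple_extension_mem[OF Es tc])
  have tpowR: "t [^]\<^bsub>F\<^esub> (k::nat) \<in> ?R" for k
    by (induct k) (use Rr(3) Rr(6)[OF _ tR] in auto)
  have step: "\<one>\<^bsub>F\<^esub> \<oplus>\<^bsub>F\<^esub> res (u \<otimes> g \<otimes> Q [^] Suc i) \<in> ?R - {\<zero>\<^bsub>F\<^esub>}"
    if a: "u \<in> val_units" "res u \<in> ?R" "g \<in> G" "v (u \<otimes> g \<otimes> Q [^] Suc i) = 0" for u g i
  proof -
    obtain g' k where k: "g' \<in> G" "v g' = 0" "Suc i = e * k" "u \<otimes> g \<otimes> Q [^] Suc i = u \<otimes> g' \<otimes> w [^] k"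
      using decomp[OF a(1,3,4)] by blast
    \<comment> \<open>The exponent \<open>Suc i\<close> is positive, hence so is \<open>k\<close>,
      and a factor \<open>t\<close> splits off. If the sum \<open>1 + s t\<close> vanished,
      \<open>t\<close> would have the inverse \<open>- s\<close> in \<open>E[t]\<close>.\<close>
    then obtain l where l: "k = Suc l" by (cases k) auto
    define s where "s = res u \<otimes>\<^bsub>F\<^esub> res g' \<otimes>\<^bsub>F\<^esub> t [^]\<^bsub>F\<^esub> l"
    have sR: "s \<in> ?R" unfolding s_def using Rr(6)[OF Rr(6)[OF a(2)] tpowR] res_G[OF k(1,2)] ER by blast
    have sc: "s \<in> carrier F" using sR Rr(1) by blast
    have "res u \<in> carrier F" "res g' \<in> carrier F" using a(2) Rr(1) res_G[OF k(1,2)] Ec by blast+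
    then have st: "res (u \<otimes> g \<otimes> Q [^] Suc i) = s \<otimes>\<^bsub>F\<^esub> t"
      unfolding k(4) res_decomp[OF a(1) k(1,2)] s_def l using tc by (simp add: F.m_assoc)
    have "\<one>\<^bsub>F\<^esub> \<oplus>\<^bsub>F\<^esub> s \<otimes>\<^bsub>F\<^esub> t \<noteq> \<zero>\<^bsub>F\<^esub>"
    proof
      assume z: "\<one>\<^bsub>F\<^esub> \<oplus>\<^bsub>F\<^esub> s \<otimes>\<^bsub>F\<^esub> t = \<zero>\<^bsub>F\<^esub>"
      have "(\<ominus>\<^bsub>F\<^esub> s) \<otimes>\<^bsub>F\<^esub> t = \<one>\<^bsub>F\<^esub>"
        using F.minus_equality[OF z] sc tc by (simp add: F.l_minus)
      then have "(F.algebraic over E) t"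
        by (rule F.algebraic_if_inverse_in_simple_extension[OF Es tc Rr(5)[OF sR]])
      then show False using transE by (simp add: over_def)
    qed
    moreover have "\<one>\<^bsub>F\<^esub> \<oplus>\<^bsub>F\<^esub> s \<otimes>\<^bsub>F\<^esub> t \<in> ?R" using Rr(7)[OF Rr(3) Rr(6)[OF sR tR]] .
    ultimately show ?thesis unfolding st by blast
  qed
  have form: "\<exists>u g i. u \<in> val_units \<and> res u \<in> ?R \<and> g \<in> G \<and> f = u \<otimes> g \<otimes> Q [^] (i::nat)"
    if "f \<in> pspan n - {\<zero>}" for f n
    by (rule Q_adic_leading_term[OF Rr(3) step that])
  let ?T = "generate_field F (insert t E)"
  have gc: "insert t E \<subseteq> carrier F" using tc Ec by blast
  have T: "subfield ?T F" by (rule F.generate_field_is_subfield[OF gc])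
  note Tr = subringE[OF subfieldE(1)[OF T]]
  have inc: "insert t E \<subseteq> ?T" by (intro subsetI generate_field.incl)
  have RT: "?R \<subseteq> ?T" by (rule F.simple_extension_subring_incl[OF subfieldE(1)[OF T]]) (use inc in auto)
  have Tinv: "inv\<^bsub>F\<^esub> res u \<in> ?T" if "res u \<in> ?T" "u \<in> val_units" for u
    using F.subfield_m_inv(1)[OF T, of "res u"] that res_nz[of u] by blast
  have resT: "res (u \<otimes> g \<otimes> Q [^] (n::nat)) \<in> ?T"
    if a: "u \<in> val_units" "res u \<in> ?T" "g \<in> G" "v (u \<otimes> g \<otimes> Q [^] n) = 0" for u g n
  proof -
    obtain g' k where k: "g' \<in> G" "v g' = 0" "u \<otimes> g \<otimes> Q [^] n = u \<otimes> g' \<otimes> w [^] k" and "n = e * k"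
      using decomp[OF a(1,3,4)] by blast
    have "res g' \<in> ?T" "t [^]\<^bsub>F\<^esub> k \<in> ?T" using res_G[OF k(1,2)] inc tpowR RT by blast+
    then show ?thesis unfolding k(3) res_decomp[OF a(1) k(1,2)] using Tr(6)[OF Tr(6)[OF a(2)]] by blast
  qed
  \<comment> \<open>For \<open>j <= i\<close> the quotient is again a single leading term, now with
    exponent \<open>i - j\<close>. The opposite order is reduced to this one by passing to the
    inverse of \<open>r\<close>.\<close>
  have quot: "res r \<in> ?T"
    if a: "r = (u \<otimes> g \<otimes> Q [^] (i::nat)) \<otimes> inv (u' \<otimes> g' \<otimes> Q [^] (j::nat))" "r \<in> val_units" "j \<le> i"
      "u \<in> val_units" "res u \<in> ?T" "u' \<in> val_units" "res u' \<in> ?T" "g \<in> G" "g' \<in> G" for r u g i u' g' j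
  proof -
    note un = val_units_nz[OF a(4)] and u'n = val_units_nz[OF a(6)] and gn = G_nz[OF a(8)] and g'n = G_nz[OF a(9)]
    have c: "u \<in> carrier L" "g \<in> carrier L" "inv u' \<in> carrier L" "inv g' \<in> carrier L" "Q [^] (i - j) \<in> carrier L"
      "Q [^] j \<in> carrier L" "inv (Q [^] j) \<in> carrier L"
      using un gn nz_inv[OF u'n] nz_inv[OF g'n] Q_pow_nz nz_inv[OF Q_pow_nz] by blast+
    have "Q [^] i = Q [^] (i - j) \<otimes> Q [^] j" using Q_nz a(3) by (simp add: nat_pow_mult)
    then have "r = (u \<otimes> g \<otimes> (Q [^] (i - j) \<otimes> Q [^] j)) \<otimes> (inv u' \<otimes> inv g' \<otimes> inv (Q [^] j))"
      unfolding a(1) inv_mult_nz[OF nz_mult[OF u'n g'n] Q_pow_nz] inv_mult_nz[OF u'n g'n] by simp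
    also have "\<dots> = ((u \<otimes> inv u') \<otimes> (g \<otimes> inv g') \<otimes> Q [^] (i - j)) \<otimes> (Q [^] j \<otimes> inv (Q [^] j))"
      using c by algebra
    finally have r: "r = (u \<otimes> inv u') \<otimes> (g \<otimes> inv g') \<otimes> Q [^] (i - j)" using c nz_r_inv[OF Q_pow_nz[of j]] by simp
    have u: "u \<otimes> inv u' \<in> val_units" by (rule val_units_mult[OF a(4) val_units_inv[OF a(6)]])
    have "res (u \<otimes> inv u') = res u \<otimes>\<^bsub>F\<^esub> inv\<^bsub>F\<^esub> res u'"
      using res_mult[OF val_units_O[OF a(4)] val_units_O[OF val_units_inv[OF a(6)]]] res_inv[OF a(6)] by simp
    then have "res (u \<otimes> inv u') \<in> ?T" using Tr(6)[OF a(5) Tinv[OF a(7,6)]] by simp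
    then show ?thesis unfolding r
      by (rule resT[OF u _ G_mult[OF a(8) G_inv[OF a(9)]]]) (use a(2) r in \<open>simp add: val_units_def\<close>)
  qed
  have unit: "res r \<in> ?T" if r: "r \<in> val_units" for r
  proof -
    note rn = val_units_nz[OF r]
    obtain n f f' where ff: "f \<in> pspan n - {\<zero>}" "f' \<in> pspan n - {\<zero>}" "r = f \<otimes> inv f'"
      by (rule fraction_pspan_nz[OF rn])
    obtain u g i where u: "u \<in> val_units" "res u \<in> ?R" "g \<in> G" "f = u \<otimes> g \<otimes> Q [^] (i::nat)"
      using form[OF ff(1)] by blast
    obtain u' g' j where u': "u' \<in> val_units" "res u' \<in> ?R" "g' \<in> G" "f' = u' \<otimes> g' \<otimes> Q [^] (j::nat)"
      using form[OF ff(2)] by blast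
    have T2: "res u \<in> ?T" "res u' \<in> ?T" using u(2) u'(2) RT by blast+
    show ?thesis
    proof (cases "j \<le> i")
      case True
      show ?thesis by (rule quot[OF _ r True u(1) T2(1) u'(1) T2(2) u(3) u'(3)]) (use ff(3) u(4) u'(4) in simp)
    next
      case False
      then have ij: "i \<le> j" by linarith
      have "inv r = f' \<otimes> inv f" unfolding ff(3)
        using inv_mult_nz[OF pspan_nz[OF ff(1)] nz_inv[OF pspan_nz[OF ff(2)]]] inv_inv_nz[OF pspan_nz[OF ff(2)]]
          m_comm[of "inv f" f'] nz_inv[OF pspan_nz[OF ff(1)]] pspan_nz[OF ff(2)] by simp
      then have "res (inv r) \<in> ?T"
        unfolding u(4) u'(4)
        by (rule quot[OF _ val_units_inv[OF r] ij u'(1) T2(2) u(1) T2(1) u'(3) u(3)])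
      then have "inv\<^bsub>F\<^esub> res (inv r) \<in> ?T" using Tinv val_units_inv[OF r] by blast
      then show ?thesis using res_inv[OF val_units_inv[OF r]] inv_inv_nz[OF rn] by simp
    qed
  qed
  have "carrier F \<subseteq> ?T"
  proof
    fix y assume "y \<in> carrier F"
    then obtain r where r: "r \<in> \<O>" "y = res r" unfolding carrier_F by blast
    show "y \<in> ?T"
    proof (cases "r \<in> val_units")
      case False
      then have "y = \<zero>\<^bsub>F\<^esub>" using val_units_iff[OF r(1)] r(2) by simp
      then show ?thesis using Tr(2) by simp
    qed (use unit r in simp)
  qed
  then have gen_T: "?T = carrier F" using Tr(1) by blast
  have "rational_function_field F E t" unfolding rational_function_field_def
    using field_F subfield_E tc transE gen_T by blast
  then have rat: "rational_over_finite_extension F Kv" unfolding rational_over_finite_extension_def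
    using subfield_E Kv_E finite_dimension_E by blast

  obtain S where S: "finite S" "S \<subseteq> nz" "\<And>g. g \<in> G \<Longrightarrow> \<exists>s\<in>S. \<exists>c\<in>Knz. v g = v s + v c"
    by (rule val_G_finite) metis
  \<comment> \<open>Representatives modulo \<open>vK\<close>: those for the values of
    \<open>G\<close>, shifted by the multiples of \<open>v Q\<close> below \<open>e\<close>.\<close>
  define S' where "S' = (\<lambda>(s, i). v s + v (Q [^] (i::nat))) ` (S \<times> {..<e})"
  have split: "v (Q [^] (a + b)) = v (Q [^] a) + v (Q [^] b)" for a b :: nat
    using val_mult[OF Q_pow_nz Q_pow_nz, of a b] Q_nz by (simp add: nat_pow_mult)
  have ek: "v (Q [^] (e * k)) = v (inv h [^] k)" for k
  proof (induct k)
    case (Suc k)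
    have "inv h [^] k \<in> nz" by (rule nz_pow[OF nz_inv[OF hn]])
    then show ?case using Suc split[of "e * k" e] val_pow[OF nz_inv[OF hn], of k] vh val_inv[OF hn]
      by (simp add: add.commute)
  qed simp
  have value_form: "\<exists>g\<in>G. \<exists>i::nat. v f = v g + v (Q [^] i)" if f: "f \<in> pspan n - {\<zero>}" for f n
  proof -
    obtain u g i where u: "u \<in> val_units" "g \<in> G" "f = u \<otimes> g \<otimes> Q [^] (i::nat)" using form[OF f] by blast
    have "v f = v g + v (Q [^] i)" unfolding u(3)
      using val_mult[OF nz_mult[OF val_units_nz[OF u(1)] G_nz[OF u(2)]] Q_pow_nz, of i]
        val_mult[OF val_units_nz[OF u(1)] G_nz[OF u(2)]] u(1) by (simp add: val_units_def)
    then show ?thesis using u(2) by blast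
  qed
  have "\<exists>s\<in>S'. \<exists>a\<in>vK. c = s + a" if c: "c \<in> vL" for c
  proof -
    obtain r where r: "r \<in> nz" "c = v r" using c unfolding value_set_def by blast
    obtain n f f' where ff: "f \<in> pspan n - {\<zero>}" "f' \<in> pspan n - {\<zero>}" "r = f \<otimes> inv f'"
      by (rule fraction_pspan_nz[OF r(1)])
    obtain g i where g: "g \<in> G" "v f = v g + v (Q [^] (i::nat))" using value_form[OF ff(1)] by blast
    obtain g' j where g': "g' \<in> G" "v f' = v g' + v (Q [^] (j::nat))" using value_form[OF ff(2)] by blast
    have vr: "v r = v f - v f'"
      using val_mult[OF pspan_nz[OF ff(1)] nz_inv[OF pspan_nz[OF ff(2)]]] val_inv[OF pspan_nz[OF ff(2)]] ff(3) by simp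
    \<comment> \<open>Since \<open>i - j\<close> may be negative, \<open>e j\<close> is added:
      \<open>m\<close> is a natural number congruent to \<open>i - j\<close> modulo
      \<open>e\<close>, and \<open>e j v Q\<close> is a value of \<open>G\<close>.\<close>
    define m where "m = i + (e * j - j)"
    have "j \<le> e * j" using e(1) by (cases e) simp_all
    then have mj: "m + j = i + e * j" unfolding m_def by linarith
    have "v (Q [^] m) + v (Q [^] j) = v (Q [^] i) + v (inv h [^] j)"
      using split[of m j] split[of i "e * j"] mj ek[of j] by simp
    then have vi: "v (Q [^] i) - v (Q [^] j) = v (Q [^] m) - v (inv h [^] j)"
      by (simp add: algebra_simps)
    have vm: "v (Q [^] m) = v (Q [^] (m mod e)) + v (inv h [^] (m div e))"
      using split[of "m mod e" "e * (m div e)"] ek[of "m div e"] by simp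
    define g'' where "g'' = g \<otimes> inv g' \<otimes> inv (inv h [^] j) \<otimes> inv h [^] (m div e)"
    have g'': "g'' \<in> G" unfolding g''_def by (intro G_mult G_inv G_pow g(1) g'(1) h)
    have p: "g \<in> nz" "inv g' \<in> nz" "inv (inv h [^] j) \<in> nz" "inv h [^] (m div e) \<in> nz"
      using G_nz[OF g(1)] nz_inv[OF G_nz[OF g'(1)]] nz_inv[OF nz_pow[OF nz_inv[OF hn]]] nz_pow[OF nz_inv[OF hn]] by blast+
    have vg'': "v g'' = v g - v g' - v (inv h [^] j) + v (inv h [^] (m div e))" unfolding g''_def
      using val_mult[OF nz_mult[OF nz_mult[OF p(1,2)] p(3)] p(4)] val_mult[OF nz_mult[OF p(1,2)] p(3)] val_mult[OF p(1,2)]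
        val_inv[OF G_nz[OF g'(1)]] val_inv[OF nz_pow[OF nz_inv[OF hn]], of j] by simp
    have "v r = (v g - v g') + (v (Q [^] i) - v (Q [^] j))" unfolding vr g(2) g'(2) by (simp add: algebra_simps)
    then have vr2: "v r = v g'' + v (Q [^] (m mod e))" unfolding vi vm vg'' by (simp add: algebra_simps)
    obtain s k where s: "s \<in> S" "k \<in> Knz" "v g'' = v s + v k" using S(3)[OF g''] by blast
    have "c = (v s + v (Q [^] (m mod e))) + v k" using r(2) vr2 s(3) by (simp add: algebra_simps)
    moreover have "v s + v (Q [^] (m mod e)) \<in> S'" unfolding S'_def using s(1) e(1)
      by (intro image_eqI[of _ _ "(s, m mod e)"]) simp_all
    moreover have "v k \<in> vK" unfolding value_set_def using s(2) by (rule imageI)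
    ultimately show ?thesis by (intro bexI)
  qed
  then have "carrier (add_grp vL Mod vK) \<subseteq> (\<lambda>s. (\<lambda>a. a + s) ` vK) ` S'"
    by (rule value_groups.carrier_quotient_subset)
  moreover have "finite S'" unfolding S'_def using S(1) by simp
  ultimately have "finite (carrier (add_grp vL Mod vK))" by (metis finite_imageI finite_subset)
  with rat show ?thesis by blast
qed

end

section \<open>The torsion-algebraic case, trichotomy and exclusion\<close>

context valued_simple_extension
begin

text \<open>Algebraic type passes from polynomials to fractions. Then
  \<open>alg_type_torsion\<close> settles the values and \<open>alg_type_unit\<close> the
  residues.\<close>

lemma torsion_algebraic_case:
  assumes "\<And>n. pspan n - {\<zero>} \<subseteq> alg_type"
  shows "torsion_group (add_grp vL Mod vK) \<and> algebraic_field_extension F Kv"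
proof -
  have type: "r \<in> alg_type" if r: "r \<in> nz" for r
  proof -
    obtain n f g where "f \<in> pspan n - {\<zero>}" "g \<in> pspan n - {\<zero>}" "r = f \<otimes> inv g"
      by (rule fraction_pspan_nz[OF r])
    then show ?thesis using alg_type_mult alg_type_inv assms by blast
  qed
  have "torsion_group (add_grp vL Mod vK)" unfolding value_groups.torsion_quotient_iff
  proof
    fix c assume "c \<in> vL"
    then obtain r where r: "r \<in> nz" "c = v r" unfolding value_set_def by blast
    obtain n k where "n > (0::nat)" "k \<in> Knz" "v (r [^] n) = v k" using type[OF r(1)] by (rule alg_type_torsion)
    then have "n > 0 \<and> c [^]\<^bsub>add_grp UNIV\<^esub> n \<in> vK"
      using val_pow_add_grp[OF r(1), of n] r(2) unfolding value_set_def by auto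
    then show "\<exists>n::nat>0. c [^]\<^bsub>add_grp UNIV\<^esub> n \<in> vK" by blast
  qed
  moreover have "(F.algebraic over Kv) y" if yF: "y \<in> carrier F" for y
  proof -
    obtain r where r: "r \<in> \<O>" "y = res r" using yF unfolding carrier_F by blast
    have "y \<in> algs"
    proof (cases "r \<in> val_units")
      case False
      then have "y = \<zero>\<^bsub>F\<^esub>" using val_units_iff[OF r(1)] r(2) by simp
      then show ?thesis using algs_ring(2) by simp
    next
      case True
      then have "r \<in> alg_units" using alg_type_unit type by (simp add: val_units_def)
      then show ?thesis using r(2) by (simp add: alg_units_def)
    qed
    then show ?thesis by (simp add: algs_def)
  qed
  ultimately show ?thesis unfolding algebraic_field_extension_def by blast
qed

lemma trichotomy:
  shows "(\<exists>\<Gamma>. finite_group_extension vK \<Gamma> \<and> iso_sum_integers_over vK \<Gamma> vL) \<and> F.finite_dimension Kv (carrier F)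
    \<or> finite (carrier (add_grp vL Mod vK)) \<and> rational_over_finite_extension F Kv
    \<or> torsion_group (add_grp vL Mod vK) \<and> algebraic_field_extension F Kv"
proof (cases "\<forall>n. pspan n - {\<zero>} \<subseteq> alg_type")
  case True
  then show ?thesis using torsion_algebraic_case by blast
next
  case False
  then obtain d Q where "key_polynomial L v K x d Q" by (rule key_polynomial_exists)
  then interpret key_polynomial L v K x d Q .
  show ?thesis
  proof (cases "\<exists>n>0. \<exists>g\<in>G. v (Q [^] (n::nat)) = v g")
    case True
    then show ?thesis using residue_transcendental_case by blast
  next
    case False
    then have indep: "\<And>n g. \<lbrakk>n > (0::nat); g \<in> G\<rbrakk> \<Longrightarrow> v (Q [^] n) \<noteq> v g" by blast
    show ?thesis
      using finite_quotient_val_G value_transcendental_value_group[OF indep]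
        value_transcendental_residue_field[OF indep] by blast
  qed
qed

text \<open>The preimage of \<open>(0, 1)\<close> has infinite order modulo \<open>vK\<close>: its
  \<open>n\<close>-th multiple has second component \<open>n\<close>, while elements of
  \<open>vK\<close> have second component zero.\<close>

lemma not_torsion_if_iso_sum_integers:
  assumes "finite_group_extension vK \<Gamma>" "iso_sum_integers_over vK \<Gamma> vL"
  shows "\<not> torsion_group (add_grp vL Mod vK)"
proof
  assume tor: "torsion_group (add_grp vL Mod vK)"
  have \<Gamma>: "subgroup \<Gamma> (add_grp UNIV)" "vK \<subseteq> \<Gamma>" using assms(1) unfolding finite_group_extension_def by blast+
  interpret A: group_pair vK \<Gamma> by (rule group_pair.intro[OF subgroup_vK \<Gamma>])
  let ?D = "add_grp \<Gamma> \<times>\<times> integer_group"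
  obtain h where h: "h \<in> iso (add_grp vL) ?D" "\<forall>a\<in>vK. h a = (a, 0)"
    using assms(2) unfolding iso_sum_integers_over_def by blast
  have D: "group ?D" by (rule DirProd_group) (use A.add_grp_C comm_group.axioms in auto)
  have C: "group (add_grp vL)" using value_groups.add_grp_C comm_group.axioms(2) by blast
  have hom: "h \<in> hom (add_grp vL) ?D" and bij: "bij_betw h vL (\<Gamma> \<times> UNIV)"
    using h(1) unfolding iso_def by auto
  interpret h: group_hom "add_grp vL" ?D h using C D hom by (intro group_hom.intro group_hom_axioms.intro)
  have "(0, 1) \<in> \<Gamma> \<times> (UNIV :: int set)" using subgroup.one_closed[OF \<Gamma>(1)] by simp
  then obtain c where c: "c \<in> vL" "h c = (0, 1)" using bij unfolding bij_betw_def by (metis imageE)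
  obtain n where n: "n > (0::nat)" "c [^]\<^bsub>add_grp UNIV\<^esub> n \<in> vK"
    using tor c(1) unfolding value_groups.torsion_quotient_iff by blast
  have "h (c [^]\<^bsub>add_grp vL\<^esub> n) = h c [^]\<^bsub>?D\<^esub> n" using h.hom_nat_pow c(1) by simp
  also have "h c [^]\<^bsub>?D\<^esub> m = (0, int m)" for m :: nat
    unfolding c(2) by (induct m) simp_all
  finally have "h (c [^]\<^bsub>add_grp UNIV\<^esub> n) = (0, int n)" by (simp add: value_groups.pow_add_grp)
  then show False using h(2) n by simp
qed

text \<open>Transcendence over \<open>E\<close> descends to the smaller field \<open>Kv\<close>, so
  the generator \<open>t\<close> is already a witness.\<close>

lemma not_algebraic_if_rational:
  assumes "rational_over_finite_extension F Kv" shows "\<not> algebraic_field_extension F Kv"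
proof
  assume alg: "algebraic_field_extension F Kv"
  obtain E t where "Kv \<subseteq> E" "t \<in> carrier F" "(F.transcendental over E) t"
    using assms unfolding rational_over_finite_extension_def rational_function_field_def by blast
  then have "(F.transcendental over Kv) t" using F.transcendental_mono by blast
  then show False using alg \<open>t \<in> carrier F\<close> unfolding algebraic_field_extension_def by (simp add: over_def)
qed

end

theorem theorem1p5:
  fixes L :: "('a, 'b) ring_scheme"
    and v :: "'a \<Rightarrow> 'g::linordered_ab_group_add"
    and K :: "'a set" and x :: 'a
  assumes "rational_function_field L K x" and "valued_field L v"
  shows "let vK = value_set L v K; vKx = value_set L v (carrier L);
             Kv = residue_subfield L v K; Kxv = residue_field L v;
             case1 = (\<exists>\<Gamma>0. finite_group_extension vK \<Gamma>0 \<and> iso_sum_integers_over vK \<Gamma>0 vKx)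
                     \<and> ring.finite_dimension Kxv Kv (carrier Kxv);
             case2 = finite (carrier (add_grp vKx Mod vK))
                     \<and> rational_over_finite_extension Kxv Kv;
             case3 = torsion_group (add_grp vKx Mod vK)
                     \<and> algebraic_field_extension Kxv Kv
         in (case1 \<or> case2 \<or> case3)
            \<and> \<not> (case1 \<and> case2) \<and> \<not> (case1 \<and> case3) \<and> \<not> (case2 \<and> case3)
            \<and> countable (carrier (add_grp vKx Mod vK))
            \<and> countably_generated_field_extension Kxv Kv"
proof -
  interpret valued_simple_extension L v K x
    using assms unfolding rational_function_field_def
    by (intro valued_simple_extension.intro valued_field_extension.intro
        valued_field_extension_axioms.intro valued_simple_extension_axioms.intro) blast+
  \<comment> \<open>Case 1 is separated from the other two by the values, because the finite
    quotient in case 2 is a torsion group as well. Cases 2 and 3 are separated by the residue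
    field.\<close>
  show ?thesis
    unfolding Let_def
    using trichotomy not_torsion_if_iso_sum_integers not_algebraic_if_rational
      value_groups.torsion_quotient_if_finite countable_value_quotient countably_generated_residue_field
    by blast
qed

end
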